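(* Let $G=\langle A\cup B\rangle$ be a fragmentation of a minimal action of a dihedral group $\langle a,b\rangle$ on a Cantor set $\mathcal{X}$. Suppose that there exists a purely non-Hausdorff singularity $\xi\in\mathcal{X}$ of the action of $G$, and that the orbital graphs of $G$ are linearly repetitive. Then the growth function of $G$ with respect to the generating set $A\cup B$ is bounded above by $\exp\left(C_1 n e^{-C_2\sqrt{\log n}}\right)$ for some positive constants $C_1$ and $C_2$ (and all $n\ge 1$).
   Context: An action by homeomorphisms is minimal if all its orbits are dense. Let $a,b$ be homeomorphisms of period two (non-identity, with square the identity) of the Cantor set $\mathcal{X}$. A fragmentation of $a$ is a finite group $A$ of homeomorphisms of $\mathcal{X}$ such that for all $h\in A$, $\zeta\in\mathcal{X}$ either $h(\zeta)=\zeta$ or $h(\zeta)=a(\zeta)$, and for every $\zeta\in\mathcal{X}$ there is $h\in A$ with $h(\zeta)=a(\zeta)$. A fragmentation of the dihedral group $\langle a,b\rangle$ is the group $G=\langle A\cup B\rangle$ generated by fragmentations $A$ of $a$ and $B$ of $b$. A point $\zeta\in\mathcal{X}$ is $G$-regular if every $g\in G$ fixing $\zeta$ fixes pointwise a neighborhood of $\zeta$; otherwise it is singular. A singular point $\xi$ is a purely non-Hausdorff singularity if for every $g\in G$ with $g(\xi)=\xi$ the interior of the set of fixed points of $g$ accumulates on $\xi$ (every neighborhood of $\xi$ contains points of it different from $\xi$). Let $S=A\cup B$. The orbital graph $\Gamma_\zeta$ has vertex set the orbit $G\zeta$, and for every $\eta\in G\zeta$, $s\in S$ there is an edge labeled $s$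 from $\eta$ to $s(\eta)$. Distances ignore orientation. $B_\eta(r)$ is the ball of radius $r$ with center $\eta$ in the orbital graph, as a labeled graph rooted at $\eta$, with all edges of the orbital graph connecting vertices of the ball. The orbital graphs of $G$ are linearly repetitive if there exists $K>1$ such that for every integer $r>1$, every $G$-regular point $\zeta$ and every $\eta\in\mathcal{X}$ there is a vertex $\eta'$ of $\Gamma_\eta$ at distance less than $Kr$ from $\eta$ such that $B_\zeta(r)$ and $B_{\eta'}(r)$ are isomorphic as rooted labeled graphs. The growth function counts, for each $n$, the elements of $G$ that are products of at most $n$ elements of $S\cup S^{-1}$. *)

theory Defs
  imports "HOL-Analysis.Analysis" "HOL-Algebra.Generated_Groups"
begin

text \<open>
  A Cantor set is modelled as a whole topological type \<open>'a\<close>, so that its self-homeomorphisms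
  are honest elements of \<open>'a \<Rightarrow> 'a\<close> and equality of homeomorphisms is equality of functions.
\<close>

definition is_cantor_set :: "'a::topological_space itself \<Rightarrow> bool" where
  "is_cantor_set _ \<longleftrightarrow>
     (euclidean :: 'a topology) homeomorphic_space
     product_topology (\<lambda>_::nat. discrete_topology (UNIV :: bool set)) UNIV"

definition homeo_group :: "('a::topological_space \<Rightarrow> 'a) monoid" where
  "homeo_group =
     \<lparr>carrier = {h. \<exists>h'. homeomorphism UNIV UNIV h h'}, mult = (\<circ>), one = id\<rparr>"

lemma group_homeo_group: "group (homeo_group :: ('a::topological_space \<Rightarrow> 'a) monoid)"
proof (rule groupI)
  fix f g :: "'a \<Rightarrow> 'a"
  assume "f \<in> carrier homeo_group" "g \<in> carrier homeo_group"
  then show "f \<otimes>\<^bsub>homeo_group\<^esub> g \<in> carrier homeo_group"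
    unfolding homeo_group_def by (auto intro: homeomorphism_compose)
next
  show "\<one>\<^bsub>homeo_group\<^esub> \<in> carrier (homeo_group :: ('a \<Rightarrow> 'a) monoid)"
    unfolding homeo_group_def using homeomorphism_ident[of "UNIV :: 'a set"]
    by (auto simp: id_def)
next
  fix f :: "'a \<Rightarrow> 'a"
  assume "f \<in> carrier homeo_group"
  then obtain f' where f: "homeomorphism UNIV UNIV f f'"
    by (auto simp: homeo_group_def)
  then have "f' \<in> carrier homeo_group" "f' \<otimes>\<^bsub>homeo_group\<^esub> f = \<one>\<^bsub>homeo_group\<^esub>"
    by (auto simp: homeo_group_def homeomorphism_symD fun_eq_iff homeomorphism_apply1
        intro: exI[of _ f])
  then show "\<exists>g\<in>carrier homeo_group. g \<otimes>\<^bsub>homeo_group\<^esub> f = \<one>\<^bsub>homeo_group\<^esub>"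
    by blast
qed (auto simp: homeo_group_def)

definition orbit_of :: "('a \<Rightarrow> 'a) set \<Rightarrow> 'a \<Rightarrow> 'a set" where
  "orbit_of G x = (\<lambda>g. g x) ` G"

definition minimal_action :: "('a::topological_space \<Rightarrow> 'a) set \<Rightarrow> bool" where
  "minimal_action G \<longleftrightarrow> (\<forall>x. closure (orbit_of G x) = UNIV)"

definition period_two :: "('a::topological_space \<Rightarrow> 'a) \<Rightarrow> bool" where
  "period_two a \<longleftrightarrow> a \<in> carrier homeo_group \<and> a \<noteq> id \<and> a \<circ> a = id"

definition fragmentation :: "('a::topological_space \<Rightarrow> 'a) \<Rightarrow> ('a \<Rightarrow> 'a) set \<Rightarrow> bool" where
  "fragmentation a A \<longleftrightarrow>
     subgroup A homeo_group \<and> finite A \<and>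
     (\<forall>h\<in>A. \<forall>x. h x = x \<or> h x = a x) \<and>
     (\<forall>x. \<exists>h\<in>A. h x = a x)"

definition regular_point :: "('a::topological_space \<Rightarrow> 'a) set \<Rightarrow> 'a \<Rightarrow> bool" where
  "regular_point G x \<longleftrightarrow>
     (\<forall>g\<in>G. g x = x \<longrightarrow> (\<exists>U. open U \<and> x \<in> U \<and> (\<forall>y\<in>U. g y = y)))"

definition purely_non_Hausdorff_singularity ::
    "('a::topological_space \<Rightarrow> 'a) set \<Rightarrow> 'a \<Rightarrow> bool" where
  "purely_non_Hausdorff_singularity G x \<longleftrightarrow>
     \<not> regular_point G x \<and>
     (\<forall>g\<in>G. g x = x \<longrightarrow> x islimpt interior {y. g y = y})"

text \<open>
  Directed multigraphs with labeled edges.  An edge is a triple (source, label, target): parallel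
  edges are possible, but are distinguished by their labels, as is the case for orbital graphs.
\<close>

record ('v, 'l) labeled_graph =
  vertices :: "'v set"
  edges :: "('v \<times> 'l \<times> 'v) set"

definition adjacency :: "('v, 'l) labeled_graph \<Rightarrow> ('v \<times> 'v) set" where
  "adjacency \<Gamma> = {(x, y). \<exists>s. (x, s, y) \<in> edges \<Gamma> \<or> (y, s, x) \<in> edges \<Gamma>}"

text \<open>
  Distance ignoring orientation.  It is only meaningful for vertices in the same connected
  component; orbital graphs with respect to a generating set are connected.
\<close>

definition graph_dist :: "('v, 'l) labeled_graph \<Rightarrow> 'v \<Rightarrow> 'v \<Rightarrow> nat" where
  "graph_dist \<Gamma> x y = (LEAST n. (x, y) \<in> adjacency \<Gamma> ^^ n)"

definition graph_ball :: "('v, 'l) labeled_graph \<Rightarrow> 'v \<Rightarrow> nat \<Rightarrow> ('v, 'l) labeled_graph" where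
  "graph_ball \<Gamma> x r =
     (let V = {y \<in> vertices \<Gamma>. graph_dist \<Gamma> x y \<le> r}
      in \<lparr>vertices = V, edges = {(y, s, z) \<in> edges \<Gamma>. y \<in> V \<and> z \<in> V}\<rparr>)"

definition rooted_isomorphic ::
    "('v, 'l) labeled_graph \<Rightarrow> 'v \<Rightarrow> ('w, 'l) labeled_graph \<Rightarrow> 'w \<Rightarrow> bool" where
  "rooted_isomorphic \<Gamma> x \<Delta> y \<longleftrightarrow>
     (\<exists>\<phi>. bij_betw \<phi> (vertices \<Gamma>) (vertices \<Delta>) \<and> \<phi> x = y \<and>
        (\<forall>u\<in>vertices \<Gamma>. \<forall>v\<in>vertices \<Gamma>. \<forall>s.
           (u, s, v) \<in> edges \<Gamma> \<longleftrightarrow> (\<phi> u, s, \<phi> v) \<in> edges \<Delta>))"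

definition orbital_graph ::
    "('a::topological_space \<Rightarrow> 'a) set \<Rightarrow> 'a \<Rightarrow> ('a, 'a \<Rightarrow> 'a) labeled_graph" where
  "orbital_graph S x =
     (let V = orbit_of (generate homeo_group S) x
      in \<lparr>vertices = V, edges = {(y, s, s y) | y s. y \<in> V \<and> s \<in> S}\<rparr>)"

definition linearly_repetitive :: "('a::topological_space \<Rightarrow> 'a) set \<Rightarrow> bool" where
  "linearly_repetitive S \<longleftrightarrow>
     (\<exists>K::real. K > 1 \<and>
        (\<forall>r::nat. r > 1 \<longrightarrow>
          (\<forall>x y. regular_point (generate homeo_group S) x \<longrightarrow>
             (\<exists>y'\<in>vertices (orbital_graph S y).
                real (graph_dist (orbital_graph S y) y y') < K * real r \<and>
                rooted_isomorphic
                  (graph_ball (orbital_graph S x) x r) x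
                  (graph_ball (orbital_graph S y) y' r) y'))))"

definition growth_function :: "('g, 'm) monoid_scheme \<Rightarrow> 'g set \<Rightarrow> nat \<Rightarrow> nat" where
  "growth_function H S n =
     card {foldr (mult H) ws \<one>\<^bsub>H\<^esub> | ws.
             length ws \<le> n \<and> set ws \<subseteq> S \<union> (\<lambda>s. inv\<^bsub>H\<^esub> s) ` S}"

end

theory Submission
  imports Defs "HOL-Real_Asymp.Real_Asymp"
begin

text \<open>
  Orbital graphs are lines whose consecutive edges carry alternately elements of \<open>A\<close> and of \<open>B\<close>.
  The singularity can be moved to a fixed point of \<open>a\<close> (or \<open>b\<close>), where the line folds to a ray. Being purely
  non-Hausdorff, it is a limit of regular points whose lines are, on long windows, palindromes that
  unfold the ray through a central edge on which a prescribed element of \<open>A\<close> does not act. A word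
  that crosses one of these palindromes, started in the same way in all of them, performs the same
  folded walk, and the parity of its crossings of the central edge makes it return in at least one
  of them. By linear repetitivity a ray segment that is longer by a constant factor contains all these
  palindromes, so the number of times at which a word of length \<open>n\<close> crosses a ray segment of length
  \<open>C ^ k\<close> is at most \<open>q ^ k * n\<close> with \<open>q < 1\<close>.

  Mark the centres of the occurrences of one long palindrome. They are far apart, since otherwise the
  palindrome would be periodic and would not contain one with another centre. By linear
  repetitivity the number of local patterns around marked edges is bounded. A word is
  determined by how it moves points to the first marked edge and, at each time at which a marked edge
  is reached, from each local pattern to the next one; those times are bounded by the number
  of crossings. Taking \<open>k\<close> of order \<open>sqrt (ln n)\<close> gives the estimate.
\<close>

text \<open>Crossings are counted for all starting points at once. Each letter permutes the
  vertices, so at any time exactly one walk stands at a given vertex, and a set of starting times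
  counts the crossings of all walks together; in particular there are at most \<open>n\<close> of
  them to begin with.

  Near the singularity the labels of edges are locally constant except at the folded edge, where the
  label depends on the direction of approach. Hence a finite family of palindromes instead of one.
  Parity can be arranged because the letters of \<open>A\<close> used at the central edge multiply
  to an element of \<open>A\<close>, and this element fixes regular points arbitrarily close to the
  singularity.

  The marks solve a problem of size. Around arbitrary vertices there may be of order
  \<open>C ^ k\<close> local patterns, and this factor could outweigh the gain in
  \<open>q ^ k * n\<close>. So general patterns are recorded only at time 0; those recorded at
  arrivals are centred at marks, and their number is bounded independently of
  \<open>k\<close>.\<close>

section \<open>Walks on labelled lines\<close>

text \<open>A line is given by the label sets of its edges; edge \<open>i\<close> joins the vertices \<open>i\<close> and \<open>i + 1\<close>.\<close>

definition step :: "'s \<Rightarrow> (int \<Rightarrow> 's set) \<Rightarrow> int \<Rightarrow> int" where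
  "step s E i = (if s \<in> E i then i + 1 else if s \<in> E (i - 1) then i - 1 else i)"

text \<open>\<open>W u\<close> is the letter applied at time \<open>u\<close>; the walk starts at time \<open>t\<close> in \<open>i\<close> and lasts \<open>k\<close> steps.\<close>

primrec walk :: "(nat \<Rightarrow> 's) \<Rightarrow> (int \<Rightarrow> 's set) \<Rightarrow> nat \<Rightarrow> int \<Rightarrow> nat \<Rightarrow> int" where
  "walk W E t i 0 = i"
| "walk W E t i (Suc k) = step (W (t + k)) E (walk W E t i k)"

definition disj_line :: "(int \<Rightarrow> 's set) \<Rightarrow> bool" where
  "disj_line E \<longleftrightarrow> (\<forall>i. E i \<inter> E (i + 1) = {})"

text \<open>Downward passages suffice, since \<open>recenter\<close> at an odd vertex reverses the
  line. The ends are visited only at the two extreme times, so the starting time determines the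
  duration.\<close>

definition traversal :: "(nat \<Rightarrow> 's) \<Rightarrow> (int \<Rightarrow> 's set) \<Rightarrow> int \<Rightarrow> int \<Rightarrow> nat \<Rightarrow> nat \<Rightarrow> bool" where
  "traversal W E l h t k \<longleftrightarrow> 0 < k \<and> walk W E t h k = l \<and>
     (\<forall>j. 0 < j \<and> j < k \<longrightarrow> l < walk W E t h j \<and> walk W E t h j < h)"

text \<open>A time stands for the walk that is at \<open>h\<close> at that time, so passages of all
  starting points are counted.\<close>

definition traversal_starts :: "(nat \<Rightarrow> 's) \<Rightarrow> nat \<Rightarrow> (int \<Rightarrow> 's set) \<Rightarrow> int \<Rightarrow> int \<Rightarrow> nat set" where
  "traversal_starts W n E l h = {t. \<exists>k. t + k \<le> n \<and> traversal W E l h t k}"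

lemma step_bounds: "i - 1 \<le> step s E i" "step s E i \<le> i + 1"
  by (auto simp: step_def)

lemma disj_lineD: "disj_line E \<Longrightarrow> s \<in> E i \<Longrightarrow> s \<notin> E (i + 1)"
  by (auto simp: disj_line_def)

lemma disj_lineD': "disj_line E \<Longrightarrow> s \<in> E i \<Longrightarrow> s \<notin> E (i - 1)"
  using disj_lineD[of E s "i - 1"] by auto

lemma step_invol: "disj_line E \<Longrightarrow> step s E (step s E i) = i"
  using disj_lineD[of E s i] disj_lineD[of E s "i-2"] by (auto simp: step_def)

lemma walk_add: "walk W E t i (j + k) = walk W E (t + j) (walk W E t i j) k"
  by (induction k) (auto simp: add.assoc)

text \<open>Steps are involutions, so walks driven by the same letters from different vertices never
  meet.\<close>

lemma walk_inj: "disj_line E \<Longrightarrow> walk W E t i k = walk W E t i' k \<Longrightarrow> i = i'"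
proof (induction k)
  case (Suc k)
  then show ?case using step_invol by (metis walk.simps(2))
qed simp

lemma walk_lipschitz: "\<bar>walk W E t i (Suc k) - walk W E t i k\<bar> \<le> 1"
  using step_bounds[where i="walk W E t i k" and s="W (t+k)" and E=E] by auto

lemma walk_ivt_down:
  assumes "m \<le> i" "walk W E t i k \<le> m"
  shows "\<exists>k'\<le>k. walk W E t i k' = m \<and> (\<forall>j<k'. walk W E t i j > m)"
proof -
  define k' where "k' = (LEAST k. walk W E t i k \<le> m)"
  have a: "walk W E t i k' \<le> m" unfolding k'_def using assms(2) by (rule LeastI)
  have b: "k' \<le> k" unfolding k'_def using assms(2) by (rule Least_le)
  have c: "\<forall>j<k'. walk W E t i j > m" unfolding k'_def using not_less_Least by force
  have "walk W E t i k' = m"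
  proof (cases k')
    case 0 then show ?thesis using a assms by auto
  next
    case (Suc j)
    then show ?thesis using a[unfolded Suc] c[rule_format, of j] walk_lipschitz[of W E t i j]
      by (simp del: walk.simps)
  qed
  then show ?thesis using b c by blast
qed

lemma walk_ivt_up:
  assumes "i \<le> m" "m \<le> walk W E t i k"
  shows "\<exists>k'\<le>k. walk W E t i k' = m"
proof -
  define k' where "k' = (LEAST k. walk W E t i k \<ge> m)"
  have a: "walk W E t i k' \<ge> m" unfolding k'_def using assms(2) by (rule LeastI)
  have b: "k' \<le> k" unfolding k'_def using assms(2) by (rule Least_le)
  have c: "\<forall>j<k'. walk W E t i j < m" unfolding k'_def using not_less_Least by force
  have "walk W E t i k' = m"
  proof (cases k')
    case 0 then show ?thesis using a assms by auto
  next
    case (Suc j)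
    then show ?thesis using a[unfolded Suc] c[rule_format, of j] walk_lipschitz[of W E t i j]
      by (simp del: walk.simps)
  qed
  then show ?thesis using b by blast
qed

text \<open>The passage runs from the last time at \<open>h\<close> or above up to the first visit
  to \<open>l\<close>.\<close>

lemma traversal_crossing:
  assumes "h \<le> i" "walk W E t i k \<le> l" "l < h"
  obtains j k' where "j + k' \<le> k" "walk W E t i j = h" "traversal W E l h (t + j) k'"
    "\<forall>m < j + k'. walk W E t i m > l"
proof -
  obtain k2 where k2: "k2 \<le> k" "walk W E t i k2 = l" "\<forall>j<k2. walk W E t i j > l"
    using walk_ivt_down[of l i W E t k] assms by force
  define Q where "Q = (\<lambda>j. j \<le> k2 \<and> h \<le> walk W E t i j)"
  define j where "j = (GREATEST j. Q j)"
  have Q0: "Q 0" using assms by (simp add: Q_def)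
  have Qj: "Q j" unfolding j_def by (rule GreatestI_nat[of Q 0 k2]) (use Q0 in \<open>auto simp: Q_def\<close>)
  have max: "j' \<le> j" if "Q j'" for j' unfolding j_def
    by (rule Greatest_le_nat[of Q j' k2]) (use that in \<open>auto simp: Q_def\<close>)
  have jk: "j < k2" using Qj k2 assms by (metis Q_def leD order_le_imp_less_or_eq)
  have lt: "walk W E t i m < h" if "j < m" "m \<le> k2" for m
    using max[of m] that by (force simp: Q_def)
  have jh: "walk W E t i j = h"
    using lt[of "Suc j"] jk Qj walk_lipschitz[of W E t i j] unfolding Q_def by linarith
  have eq: "walk W E (t + j) h m = walk W E t i (j + m)" for m
    using walk_add[of W E t i j m] jh by simp
  have "traversal W E l h (t + j) (k2 - j)"
    unfolding traversal_def eq using jk k2 lt by auto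
  then show ?thesis using that[of j "k2 - j"] jk k2 jh by auto
qed

section \<open>Comparison of sets of starting times\<close>

lemma traversal_unique: "traversal W E l h t k \<Longrightarrow> traversal W E l h t k' \<Longrightarrow> k = k'"
  unfolding traversal_def by (metis less_irrefl linorder_neqE_nat)

lemma finite_traversal_starts [simp]: "finite (traversal_starts W n E l h)"
  by (rule finite_subset[of _ "{..n}"]) (auto simp: traversal_starts_def)

lemma card_traversal_starts_le: "card (traversal_starts W n E l h) \<le> n"
proof -
  have "traversal_starts W n E l h \<subseteq> {..<n}" by (auto simp: traversal_starts_def traversal_def)
  then show ?thesis using card_mono[of "{..<n}"] by fastforce
qed

text \<open>With the same upper end the same time serves: a passage meets \<open>h\<close> only at
  its beginning, so the shorter passage found inside it starts there too.\<close>

lemma traversal_starts_mono: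
  assumes "l \<le> l'" "l' < h"
  shows "traversal_starts W n E l h \<subseteq> traversal_starts W n E l' h"
proof
  fix t assume "t \<in> traversal_starts W n E l h"
  then obtain k where k: "t + k \<le> n" "traversal W E l h t k" by (auto simp: traversal_starts_def)
  have "walk W E t h k \<le> l'" using k assms by (simp add: traversal_def)
  then obtain j k' where j: "j + k' \<le> k" "walk W E t h j = h" "traversal W E l' h (t + j) k'"
    using traversal_crossing[of h h W E t k l'] assms(2) by blast
  have "0 < k'" using j(3) by (simp add: traversal_def)
  then have "j < k" using j(1) by linarith
  then have "j = 0" using k(2) j(2) by (metis traversal_def gr0I less_irrefl)
  then have "traversal W E l' h t k'" "t + k' \<le> n" using j k by auto
  then show "t \<in> traversal_starts W n E l' h" by (auto simp: traversal_starts_def)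
qed

text \<open>A passage through the large interval contains a later one through the small interval.
  The resulting map of starting times is injective: inner passages that begin simultaneously belong
  to the same walk by \<open>walk_inj\<close>, and this walk would revisit \<open>h\<close> during
  its outer passage.\<close>

lemma card_traversal_starts_sub:
  assumes d: "disj_line E" and "l \<le> l'" "l' < h'" "h' \<le> h"
  shows "card (traversal_starts W n E l h) \<le> card (traversal_starts W n E l' h')"
proof -
  define P where "P = (\<lambda>t j. walk W E t h j = h' \<and> t + j \<in> traversal_starts W n E l' h' \<and>
     (\<forall>m. 0 < m \<and> m \<le> j \<longrightarrow> walk W E t h m < h))"
  have ex: "\<exists>j. P t j" if tin: "t \<in> traversal_starts W n E l h" for t
  proof -
    obtain k where k: "t + k \<le> n" "traversal W E l h t k" using tin by (auto simp: traversal_starts_def)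
    have "walk W E t h k \<le> l'" using k assms by (simp add: traversal_def)
    then obtain j k' where j: "j + k' \<le> k" "walk W E t h j = h'" "traversal W E l' h' (t + j) k'"
      using traversal_crossing[of h' h W E t k l'] assms by blast
    have "0 < k'" using j(3) by (simp add: traversal_def)
    have "t + j + k' \<le> n" using j k by auto
    then have "t + j \<in> traversal_starts W n E l' h'" using j by (auto simp: traversal_starts_def)
    moreover have "walk W E t h m < h" if m: "0 < m" "m \<le> j" for m
      using k(2) m j(1) \<open>0 < k'\<close> unfolding traversal_def by auto
    ultimately have "P t j" unfolding P_def using j by blast
    then show ?thesis ..
  qed
  define f where "f = (\<lambda>t. SOME j. P t j)"
  have f: "P t (f t)" if "t \<in> traversal_starts W n E l h" for t
    unfolding f_def using ex[OF that] by (rule someI_ex)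
  have le: "\<not> t < t'" if t: "P t j" "P t' j'" "t + j = t' + j'" for t t' j j'
  proof
    assume "t < t'"
    then obtain m where m: "t' = t + m" "0 < m" by (metis less_imp_add_positive)
    then have jj: "j = m + j'" using t by auto
    have "walk W E t h j = walk W E t' (walk W E t h m) j'" unfolding jj walk_add m ..
    then have "walk W E t' (walk W E t h m) j' = walk W E t' h j'" using t by (simp add: P_def)
    then have "walk W E t h m = h" using walk_inj[OF d] by blast
    then show False using t(1) m jj by (force simp: P_def)
  qed
  have "inj_on (\<lambda>t. t + f t) (traversal_starts W n E l h)"
    by (rule inj_onI) (metis f le linorder_neqE_nat)
  moreover have "(\<lambda>t. t + f t) ` traversal_starts W n E l h \<subseteq> traversal_starts W n E l' h'"
    using f by (auto simp: P_def)
  ultimately show ?thesis by (rule card_inj_on_le) simp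
qed

text \<open>Nothing is known about edge \<open>h\<close> of the two lines, so the first step is
  special: it goes down, its letter lies on edge \<open>h - 1\<close>, and disjointness keeps this
  letter off edge \<open>h\<close> in both lines.\<close>

lemma walk_shift:
  assumes d: "disj_line E" "disj_line E'"
    and eq: "\<And>j. l \<le> j \<Longrightarrow> j < h \<Longrightarrow> E' (c + j) = E j"
    and T: "traversal W E l h t k" and lh: "l < h"
  shows "j \<le> k \<Longrightarrow> walk W E' t (c + h) j = c + walk W E t h j"
proof (induction j)
  case (Suc j)
  let ?p = "walk W E t h j" and ?s = "W (t + j)"
  have IH: "walk W E' t (c + h) j = c + ?p" using Suc by auto
  show ?case
  proof (cases "j = 0")
    case True
    have "walk W E t h 1 < h" using T lh unfolding traversal_def by (cases "k = 1") auto
    then have "?s \<in> E (h - 1)" using True by (auto simp: step_def split: if_splits)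
    moreover have "?s \<in> E' (c + (h - 1))" using eq[of "h-1"] lh calculation by auto
    moreover have "?s \<notin> E h" "?s \<notin> E' (c + h)"
      using disj_lineD[OF d(1), of ?s "h-1"] disj_lineD[OF d(2), of ?s "c + (h-1)"] calculation by (auto simp: algebra_simps)
    ultimately show ?thesis using True by (auto simp: step_def algebra_simps)
  next
    case False
    then have p: "l < ?p" "?p < h" using T Suc by (auto simp: traversal_def)
    have "E' (c + ?p) = E ?p" "E' (c + (?p - 1)) = E (?p - 1)" using p by (auto intro!: eq)
    then show ?thesis using IH by (auto simp: step_def algebra_simps)
  qed
qed simp

lemma traversal_shift:
  assumes "disj_line E" "disj_line E'"
    and "\<And>j. l \<le> j \<Longrightarrow> j < h \<Longrightarrow> E' (c + j) = E j"
    and "traversal W E l h t k" and "l < h"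
  shows "traversal W E' (c + l) (c + h) t k"
proof -
  have eq: "walk W E' t (c + h) j = c + walk W E t h j" if "j \<le> k" for j
    using walk_shift[of E E' l h c W t k j] that assms by blast
  show ?thesis using assms(4) unfolding traversal_def by (auto simp: eq)
qed

lemma traversal_starts_shift:
  assumes "disj_line E" "disj_line E'"
    and "\<And>j. l \<le> j \<Longrightarrow> j < h \<Longrightarrow> E' (c + j) = E j" and "l < h"
  shows "traversal_starts W n E l h \<subseteq> traversal_starts W n E' (c + l) (c + h)"
  using traversal_shift[of E E' l h c W] assms unfolding traversal_starts_def by blast

text \<open>The line as seen from its vertex \<open>v\<close>. It is reversed at odd \<open>v\<close>, so that even edges keep carrying
  elements of \<open>A\<close>; \<open>chart v\<close> translates the new coordinates to the old ones.\<close>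

definition recenter :: "(int \<Rightarrow> 's set) \<Rightarrow> int \<Rightarrow> int \<Rightarrow> 's set" where
  "recenter E v j = (if even v then E (v + j) else E (v - j - 1))"

definition chart :: "int \<Rightarrow> int \<Rightarrow> int" where
  "chart v w = (if even v then v + w else v - w)"

lemma recenter_recenter: "recenter (recenter E v) w = recenter E (chart v w)"
  by (auto simp: recenter_def chart_def fun_eq_iff algebra_simps)

lemma disj_line_recenter:
  "disj_line E \<Longrightarrow> disj_line (recenter E v)"
proof -
  assume d: "disj_line E"
  show "disj_line (recenter E v)"
    unfolding disj_line_def
  proof
    fix i
    have "E (v + i) \<inter> E (v + i + 1) = {}" "E (v - i - 2) \<inter> E (v - i - 2 + 1) = {}"
      using d unfolding disj_line_def by blast+
    moreover have "v - i - 2 + 1 = v - i - 1" "v - (i + 1) - 1 = v - i - 2" by auto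
    ultimately show "recenter E v i \<inter> recenter E v (i + 1) = {}"
      by (auto simp: recenter_def add.assoc)
  qed
qed

text \<open>\<open>step\<close> tries the right edge before the left one, and reversal exchanges
  them; disjointness makes the order immaterial.\<close>

lemma step_recenter: "disj_line E \<Longrightarrow> step s E (chart v j) = chart v (step s (recenter E v) j)"
  using disj_lineD[of E s "v-j-1"] disj_lineD[of E s "v+j-1"]
  by (auto simp: step_def recenter_def chart_def algebra_simps)

lemma walk_recenter: "disj_line E \<Longrightarrow> walk W E t (chart v j) k = chart v (walk W (recenter E v) t j k)"
  by (induction k) (auto simp: step_recenter)

section \<open>Folding palindromic lines onto a ray\<close>

definition pal_line :: "(int \<Rightarrow> 's set) \<Rightarrow> 's set \<Rightarrow> int \<Rightarrow> 's set" where
  "pal_line L D j = (if j = 0 then D else L \<bar>j\<bar>)"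

text \<open>Edge 0 joins the vertices 0 and 1, so the reflection of edges \<open>j\<close> to
  \<open>- j\<close> takes the vertex \<open>v\<close> to \<open>1 - v\<close>. For
  \<open>D = {}\<close> the vertices from 1 on form the ray, detached from its mirror image.\<close>

definition fold_pos :: "int \<Rightarrow> int" where "fold_pos v = (if v \<ge> 1 then v else 1 - v)"

text \<open>At the central edge a letter of \<open>D\<close> exchanges 0 and 1, which both fold to
  1. By disjointness it is not in \<open>L 1\<close>, so on the ray it stays at 1.\<close>

lemma step_fold: 
  assumes "disj_line (pal_line L D)"
  shows "fold_pos (step s (pal_line L D) v) = step s (pal_line L {}) (fold_pos v)"
proof -
  have 1: "s \<in> L \<bar>v\<bar> \<Longrightarrow> s \<notin> L \<bar>v - 1\<bar>" if "v \<noteq> 0" "v \<noteq> 1"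
    using disj_lineD'[OF assms, of s v] that by (auto simp: pal_line_def)
  have 2: "s \<in> D \<Longrightarrow> s \<notin> L 1"
    using disj_lineD'[OF assms, of s 0]  by (auto simp: pal_line_def)
  consider "v \<ge> 2" | "v = 1" | "v = 0" | "v \<le> -1" by linarith
  then show ?thesis
  proof cases
    case 1 then show ?thesis by (auto simp: step_def pal_line_def fold_pos_def)
  next
    case 2 with \<open>s \<in> D \<Longrightarrow> s \<notin> L 1\<close> show ?thesis by (auto simp: step_def pal_line_def fold_pos_def)
  next
    case 3 with \<open>s \<in> D \<Longrightarrow> s \<notin> L 1\<close> show ?thesis by (auto simp: step_def pal_line_def fold_pos_def)
  next
    case 4
    then have "v \<noteq> 0" "v \<noteq> 1" "\<bar>v\<bar> = - v" "\<bar>v - 1\<bar> = 1 - v" by auto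
    then show ?thesis using 4 1 by (auto simp: step_def pal_line_def fold_pos_def)
  qed
qed

lemma walk_fold:
  assumes "disj_line (pal_line L D)"
  shows "fold_pos (walk W (pal_line L D) t i k) = walk W (pal_line L {}) t (fold_pos i) k"
  by (induction k) (simp_all add: step_fold[OF assms])

text \<open>The folded walk alone shows when the walk is at the central edge. The set
  \<open>D\<close> only decides which of these visits are crossings.\<close>

lemma walk_side:
  assumes "disj_line (pal_line L D)" and i: "i \<ge> 1"
  shows "walk W (pal_line L D) t i k \<ge> 1 \<longleftrightarrow>
     even (card {u. u < k \<and> walk W (pal_line L {}) t i u = 1 \<and> W (t + u) \<in> D})"
proof (induction k)
  case 0 then show ?case using i by simp
next
  case (Suc k)
  let ?p = "walk W (pal_line L D) t i k" and ?s = "W (t + k)"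
  let ?U = "\<lambda>k. {u. u < k \<and> walk W (pal_line L {}) t i u = 1 \<and> W (t + u) \<in> D}"
  have f: "walk W (pal_line L {}) t i k = fold_pos ?p"
    using walk_fold[OF assms(1), of W t i k] i by (simp add: fold_pos_def)
  have U: "?U (Suc k) = (if fold_pos ?p = 1 \<and> ?s \<in> D then insert k (?U k) else ?U k)"
    by (auto simp: f less_Suc_eq)
  have fin: "finite (?U k)" by simp
  have c: "card (?U (Suc k)) = (if fold_pos ?p = 1 \<and> ?s \<in> D then Suc (card (?U k)) else card (?U k))"
    unfolding U using fin by simp
  have "step ?s (pal_line L D) ?p \<ge> 1 \<longleftrightarrow> (if fold_pos ?p = 1 \<and> ?s \<in> D then \<not> ?p \<ge> 1 else ?p \<ge> 1)"
  proof -
    have 2: "?s \<in> D \<Longrightarrow> ?s \<notin> L 1"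
      using disj_lineD'[OF assms(1), of ?s 0]  by (auto simp: pal_line_def)
    consider "?p \<ge> 2" | "?p = 1" | "?p = 0" | "?p \<le> -1" by linarith
    then show ?thesis
    proof cases
      case 1
      then show ?thesis using step_bounds[where i="?p" and s="?s" and E="pal_line L D"] by (auto simp: fold_pos_def)
    next
      case 4
      then show ?thesis using step_bounds[where i="?p" and s="?s" and E="pal_line L D"] by (auto simp: fold_pos_def)
    qed (use 2 in \<open>auto simp: step_def pal_line_def fold_pos_def\<close>)
  qed
  then show ?case using Suc c by auto
qed

section \<open>Crossings of palindromes\<close>

text \<open>\<open>Ls\<close> are the lines of the regular points, \<open>L\<close> is the ray of the singularity (only its values at
  positive arguments matter) and \<open>Ps\<close> are the central edges of the palindromes unfolding it.\<close>

locale line_system =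
  fixes S :: "'s set" and Ls :: "(int \<Rightarrow> 's set) set" and L :: "int \<Rightarrow> 's set"
    and Ps :: "'s set set" and K :: nat
  assumes disj: "E \<in> Ls \<Longrightarrow> disj_line E"
    and recenter_in: "E \<in> Ls \<Longrightarrow> recenter E v \<in> Ls"
    and repetitive: "r \<ge> 2 \<Longrightarrow> E \<in> Ls \<Longrightarrow> E' \<in> Ls \<Longrightarrow>
      \<exists>c. \<bar>c\<bar> \<le> int K * int r \<and> (\<forall>j. - int r \<le> j \<and> j < int r \<longrightarrow> recenter E' c j = E j)"
    and finite_Ps: "finite Ps"
    and realized: "D \<in> Ps \<Longrightarrow> \<exists>E\<in>Ls. \<forall>j. \<bar>j\<bar> \<le> int r \<longrightarrow> E j = pal_line L D j"
    and parity: "finite U \<Longrightarrow> (\<forall>u\<in>U. W u \<in> S) \<Longrightarrow> \<exists>D\<in>Ps. even (card {u \<in> U. W (u::nat) \<in> D})"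
    and Ps_ne: "D \<in> Ps \<Longrightarrow> D \<noteq> {}" and Ps_sub: "D \<in> Ps \<Longrightarrow> D \<subseteq> S"
begin

lemma Ps_nonempty: "Ps \<noteq> {}"
  using parity[of "{}"] by auto

text \<open>Parity for a single time: a letter of \<open>D\<close> is absent from some central
  edge.\<close>

lemma Ps_two:
  assumes "D \<in> Ps" obtains D' where "D' \<in> Ps" "D' \<noteq> D"
proof -
  obtain s where s: "s \<in> D" using Ps_ne assms by blast
  then obtain D' where "D' \<in> Ps" "even (card {u \<in> {0::nat}. s \<in> D'})"
    using parity[of "{0}" "\<lambda>_. s"] Ps_sub[OF assms] by auto
  moreover from this have "s \<notin> D'" by (auto split: if_splits)
  ultimately show ?thesis using that s by blast
qed

lemma disj_pal: 
  assumes "D \<in> Ps" shows "disj_line (pal_line L D)"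
  unfolding disj_line_def
proof
  fix i
  obtain E where E: "E \<in> Ls" "\<forall>j. \<bar>j\<bar> \<le> int (nat (\<bar>i\<bar> + 1)) \<longrightarrow> E j = pal_line L D j"
    using realized[OF assms] by blast
  then have "E i = pal_line L D i" "E (i+1) = pal_line L D (i+1)" by auto
  then show "pal_line L D i \<inter> pal_line L D (i + 1) = {}"
    using disj[OF E(1)] unfolding disj_line_def by metis
qed

lemma disj_pal_empty: "disj_line (pal_line L {})"
proof -
  obtain D where "D \<in> Ps" using Ps_nonempty by blast
  then have d: "pal_line L D i \<inter> pal_line L D (i + 1) = {}" for i
    using disj_pal unfolding disj_line_def by blast
  have "pal_line L {} i \<inter> pal_line L {} (i + 1) = {}" for i
  proof (cases "i = 0 \<or> i + 1 = 0")
    case False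
    then show ?thesis using d[of i] by (simp add: pal_line_def)
  qed (auto simp: pal_line_def)
  then show ?thesis unfolding disj_line_def by blast
qed

section \<open>Palindromes along a line\<close>

lemma pal_line_minus: "pal_line L D (- j) = pal_line L D j"
  by (simp add: pal_line_def)

text \<open>Repetitivity is used with radius \<open>r + 1\<close>, since its window is half-open and
  its radius must be at least 2. If it returns an odd vertex \<open>w\<close>, the view from there
  is reversed and the palindrome is centred at \<open>w - 1\<close>, the even edge at
  \<open>w\<close>; this costs the additional 1.\<close>

lemma pal_near:
  assumes E: "E \<in> Ls" and D: "D \<in> Ps" and r: "r \<ge> 1"
  obtains c where "even c" "\<bar>c - b\<bar> \<le> int K * (int r + 1) + 1"
    "\<And>j. \<bar>j\<bar> \<le> int r \<Longrightarrow> E (c + j) = pal_line L D j"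
proof -
  obtain E1 where E1: "E1 \<in> Ls" "\<forall>j. \<bar>j\<bar> \<le> int (r + 1) \<longrightarrow> E1 j = pal_line L D j"
    using realized[OF D] by blast
  obtain c where c: "\<bar>c\<bar> \<le> int K * int (r + 1)"
    "\<forall>j. - int (r + 1) \<le> j \<and> j < int (r + 1) \<longrightarrow> recenter (recenter E b) c j = E1 j"
    using repetitive[of "r + 1" E1 "recenter E b"] r E1 recenter_in[OF E] by auto
  define w where "w = chart b c"
  have wb: "\<bar>w - b\<bar> \<le> int K * (int r + 1)" using c by (auto simp: w_def chart_def algebra_simps)
  have w: "recenter E w j = pal_line L D j" if "\<bar>j\<bar> \<le> int r" for j
  proof -
    have "- int (r + 1) \<le> j \<and> j < int (r + 1)" "\<bar>j\<bar> \<le> int (r + 1)" using that by auto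
    then show ?thesis using c(2) E1(2) unfolding recenter_recenter w_def by auto
  qed
  show ?thesis
  proof (cases "even w")
    case True
    then show ?thesis using that[of w] wb w by (auto simp: recenter_def)
  next
    case False
    have "E (w - 1 + j) = pal_line L D j" if "\<bar>j\<bar> \<le> int r" for j
      using w[of "-j"] that False by (auto simp: recenter_def pal_line_minus algebra_simps)
    then show ?thesis using that[of "w - 1"] wb False by auto
  qed
qed

text \<open>Large enough, with room, for a ray segment of length \<open>C * r\<close> to contain a
  palindrome of radius \<open>r\<close> found by \<open>pal_near\<close>.\<close>

definition C :: nat where "C = 6 * K + 12"

lemma pal_contained:
  assumes D: "D \<in> Ps" and r: "r \<ge> 1"
  obtains c where "int r + 1 \<le> c" "c + int r \<le> int (C * r)"
    "\<And>j D0. \<bar>j\<bar> \<le> int r \<Longrightarrow> pal_line L D0 (c + j) = pal_line L D j"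
proof -
  obtain E where E: "E \<in> Ls" "\<forall>j. \<bar>j\<bar> \<le> int (C * r) \<longrightarrow> E j = pal_line L D j"
    using realized[OF D] by blast
  \<comment> \<open>Far enough from 0 that the error of \<open>pal_near\<close> leaves the whole
    window at positive edges. There every \<open>pal_line\<close> agrees with the ray, so
    \<open>D0\<close> is arbitrary.\<close>
  define v where "v = (int K + 2) * (int r + 1)"
  obtain c where c: "\<bar>c - v\<bar> \<le> int K * (int r + 1) + 1"
    "\<And>j. \<bar>j\<bar> \<le> int r \<Longrightarrow> E (c + j) = pal_line L D j"
    using pal_near[OF E(1) D r] by metis
  have l: "int r + 1 \<le> c" using c(1) by (auto simp: v_def algebra_simps)
  have K: "int K \<le> int K * int r" using r by (cases r) (auto simp: algebra_simps)
  have u: "c + int r \<le> int (C * r)" using c(1) K r by (auto simp: v_def C_def algebra_simps)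
  have "pal_line L D0 (c + j) = pal_line L D j" if "\<bar>j\<bar> \<le> int r" for j D0
  proof -
    have "c + j \<ge> 1" "\<bar>c + j\<bar> \<le> int (C * r)" using that l u by auto
    then have "E (c + j) = pal_line L D0 (c + j)" using E(2)[rule_format, of "c+j"] by (auto simp: pal_line_def)
    then show ?thesis using c(2)[OF that] by simp
  qed
  then show ?thesis using that l u by blast
qed

lemma C_pos: "C \<ge> 2" by (simp add: C_def)

text \<open>If two central edges were at small distance \<open>d\<close>, the palindrome would have period \<open>d\<close>
  on a long window, which also contains a palindrome with a different central edge.\<close>

lemma pal_separated:
  assumes D: "D \<in> Ps" 
    and 1: "\<And>j. \<bar>j\<bar> \<le> int \<rho> \<Longrightarrow> E (c + j) = pal_line L D j"
    and 2: "\<And>j. \<bar>j\<bar> \<le> int \<rho> \<Longrightarrow> E (c' + j) = pal_line L D j"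
    and lt: "c < c'"
  shows "int \<rho> < int C * (c' - c)"
proof (rule ccontr)
  assume n: "\<not> ?thesis"
  obtain D' where D': "D' \<in> Ps" "D' \<noteq> D" using Ps_two[OF D] by blast
  define d where "d = nat (c' - c)"
  have d: "d \<ge> 1" "c' = c + int d" using lt by (auto simp: d_def)
  obtain z where z: "int d + 1 \<le> z" "z + int d \<le> int (C * d)"
    "\<And>j D0. \<bar>j\<bar> \<le> int d \<Longrightarrow> pal_line L D0 (z + j) = pal_line L D' j"
    using pal_contained[OF D'(1) d(1)] by metis
  have \<rho>: "int (C * d) \<le> int \<rho>" using n d by (auto simp: algebra_simps)
  have per: "pal_line L D (j + int d) = pal_line L D j" if "0 \<le> j" "j + int d \<le> int \<rho>" for j
    using 1[of "j + int d"] 2[of j] d that by (auto simp: algebra_simps)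
  \<comment> \<open>The second palindrome has the supposed period \<open>d\<close> as its radius. A
    shift by \<open>d\<close> takes its centre to its last edge, whose label is that of edge
    \<open>d\<close>, and by periodicity this is the label of the first centre.\<close>
  have "D' = pal_line L D z" using z(3)[of 0 D] by (simp add: pal_line_def)
  also have "\<dots> = pal_line L D (z + int d)" using per[of z] z \<rho> by simp
  also have "\<dots> = pal_line L D' (int d)" using z(3)[of "int d"] by simp
  also have "\<dots> = pal_line L D (int d)" using d by (simp add: pal_line_def)
  also have "\<dots> = pal_line L D 0" using per[of 0] z \<rho> d by simp
  also have "\<dots> = D" by (simp add: pal_line_def)
  finally show False using D' by simp
qed

section \<open>Contraction of the number of crossings\<close>

lemma pal_starts_subset:
  assumes "D \<in> Ps" "r \<ge> 1"
  shows "traversal_starts W n (pal_line L D) (- int r) (int r + 1) \<subseteq> traversal_starts W n (pal_line L {}) 1 (int r + 1)"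
proof -
  have "traversal_starts W n (pal_line L D) (- int r) (int r + 1) \<subseteq> traversal_starts W n (pal_line L D) 1 (int r + 1)"
    using traversal_starts_mono[of "- int r" 1 "int r + 1"] assms by auto
  also have "\<dots> \<subseteq> traversal_starts W n (pal_line L {}) (0 + 1) (0 + (int r + 1))"
    by (rule traversal_starts_shift) (use disj_pal[OF assms(1)] disj_pal_empty assms in \<open>auto simp: pal_line_def\<close>)
  finally show ?thesis by simp
qed

text \<open>All walks entering a palindrome from the right fold to the same walk; the central edge
  only decides, by the parity of its crossings, on which side the walk leaves.\<close>

lemma pal_starts_miss:
  assumes W: "\<And>u. W u \<in> S" 
  obtains D where "D \<in> Ps" "t \<notin> traversal_starts W n (pal_line L D) (- int r) (int r + 1)"
proof (rule ccontr)
  note ob = that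
  assume nth: "\<not> thesis"
  have all: "t \<in> traversal_starts W n (pal_line L D) (- int r) (int r + 1)" if DP: "D \<in> Ps" for D
    using nth ob[OF DP] by blast
  define q where "q = walk W (pal_line L {}) t (int r + 1)"
  have T: "\<exists>k>0. walk W (pal_line L D) t (int r + 1) k = - int r \<and> q k = int r + 1 \<and>
      (\<forall>j. 0 < j \<and> j < k \<longrightarrow> q j < int r + 1)" if D: "D \<in> Ps" for D
  proof -
    let ?p = "walk W (pal_line L D) t (int r + 1)"
    obtain k where k: "traversal W (pal_line L D) (- int r) (int r + 1) t k"
      using all[OF D] by (auto simp: traversal_starts_def)
    have f: "q j = fold_pos (?p j)" for j
      using walk_fold[OF disj_pal[OF D], of W t "int r + 1" j] by (simp add: q_def fold_pos_def)
    show ?thesis using k unfolding traversal_def f by (intro exI[of _ k]) (auto simp: fold_pos_def)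
  qed
  obtain D0 where D0: "D0 \<in> Ps" using Ps_nonempty by blast
  obtain k where k: "k > 0" "q k = int r + 1" "\<forall>j. 0 < j \<and> j < k \<longrightarrow> q j < int r + 1"
    using T[OF D0] by blast
  \<comment> \<open>These are the times when the folded walk is at vertex 1 before its first return
    to \<open>r + 1\<close>. They do not depend on the central edge, so \<open>D\<close> may be
    chosen after them.\<close>
  define U where "U = (\<lambda>u. t + u) ` {u. u < k \<and> q u = 1}"
  have "finite U" by (simp add: U_def)
  then obtain D where D: "D \<in> Ps" "even (card {u \<in> U. W u \<in> D})"
    using parity[of U W] W by blast
  obtain k' where k': "k' > 0" "walk W (pal_line L D) t (int r + 1) k' = - int r" "q k' = int r + 1"
      "\<forall>j. 0 < j \<and> j < k' \<longrightarrow> q j < int r + 1"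
    using T[OF D(1)] by blast
  \<comment> \<open>Both are the first return time of the folded walk to
    \<open>r + 1\<close>.\<close>
  have "k = k'" using k k' by (metis less_irrefl linorder_neqE_nat)
  have "{u \<in> U. W u \<in> D} = (\<lambda>u. t + u) ` {u. u < k \<and> q u = 1 \<and> W (t + u) \<in> D}"
    by (auto simp: U_def)
  then have "card {u \<in> U. W u \<in> D} = card {u. u < k \<and> q u = 1 \<and> W (t + u) \<in> D}"
    by (simp add: card_image)
  then have "walk W (pal_line L D) t (int r + 1) k \<ge> 1"
    using walk_side[OF disj_pal[OF D(1)], of "int r + 1" W t k] D(2) by (simp add: q_def)
  then show False using k' \<open>k = k'\<close> by simp
qed

text \<open>Double counting of pairs of a central edge \<open>D\<close> and a time that starts a
  passage through its palindrome. Each \<open>D\<close> has at least as many times as there are long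
  passages, since the long ray segment contains its palindrome; each time has at most
  \<open>card Ps - 1\<close> central edges, since some palindrome is not crossed.\<close>

lemma inward_contract:
  assumes W: "\<And>u. W u \<in> S" and r: "r \<ge> 1"
  shows "card Ps * card (traversal_starts W n (pal_line L {}) 1 (int (C * r) + 1))
     \<le> (card Ps - 1) * card (traversal_starts W n (pal_line L {}) 1 (int r + 1))"
    (is "_ * card ?B \<le> _ * card ?I")
proof -
  let ?D = "\<lambda>D. traversal_starts W n (pal_line L D) (- int r) (int r + 1)"
  have 1: "card ?B \<le> card (?D D)" if D: "D \<in> Ps" for D
  proof -
    obtain c where c: "int r + 1 \<le> c" "c + int r \<le> int (C * r)"
      "\<And>j D0. \<bar>j\<bar> \<le> int r \<Longrightarrow> pal_line L D0 (c + j) = pal_line L D j"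
      using pal_contained[OF D r] by metis
    have "card ?B \<le> card (traversal_starts W n (pal_line L {}) (c + - int r) (c + (int r + 1)))"
      by (rule card_traversal_starts_sub) (use c(1,2) disj_pal_empty in auto)
    also have "\<dots> \<le> card (traversal_starts W n (pal_line L D) (- c + (c + - int r)) (- c + (c + (int r + 1))))"
    proof (rule card_mono)
      have "pal_line L D (- c + j) = pal_line L {} j" if "c + - int r \<le> j" "j < c + (int r + 1)" for j
      proof -
        have "\<bar>j - c\<bar> \<le> int r" using that by auto
        from c(3)[OF this, of "{}"] show ?thesis by simp
      qed
      then show "traversal_starts W n (pal_line L {}) (c + - int r) (c + (int r + 1)) \<subseteq>
        traversal_starts W n (pal_line L D) (- c + (c + - int r)) (- c + (c + (int r + 1)))"
        by (intro traversal_starts_shift disj_pal[OF D] disj_pal_empty) auto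
    qed simp
    finally show ?thesis by simp
  qed
  have fin: "finite Ps" "finite ?I" using finite_Ps by auto
  have "card Ps * card ?B \<le> (\<Sum>D\<in>Ps. card (?D D))"
    using sum_mono[of Ps "\<lambda>_. card ?B" "\<lambda>D. card (?D D)"] 1 by simp
  also have "\<dots> = (\<Sum>D\<in>Ps. \<Sum>t\<in>?I. if t \<in> ?D D then 1 else 0)"
  proof (rule sum.cong)
    fix D assume "D \<in> Ps"
    then have "?I \<inter> {t. t \<in> ?D D} = ?D D" using pal_starts_subset[of D r W n] r by blast
    then show "card (?D D) = (\<Sum>t\<in>?I. if t \<in> ?D D then 1 else 0)"
      by (simp only: sum.If_cases[OF fin(2)] card_eq_sum sum.neutral_const add_0_right)
  qed simp
  also have "\<dots> = (\<Sum>t\<in>?I. \<Sum>D\<in>Ps. if t \<in> ?D D then 1 else 0)" by (rule sum.swap)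
  also have "\<dots> \<le> (\<Sum>t\<in>?I. card Ps - 1)"
  proof (rule sum_mono)
    fix t assume "t \<in> ?I"
    obtain D where D: "D \<in> Ps" "t \<notin> ?D D" by (rule pal_starts_miss[OF W])
    have "(\<Sum>D\<in>Ps. if t \<in> ?D D then 1 else 0) = card (Ps \<inter> {D. t \<in> ?D D})"
      by (simp only: sum.If_cases[OF fin(1)] card_eq_sum sum.neutral_const add_0_right)
    also have "\<dots> \<le> card (Ps - {D})" using D fin by (intro card_mono) blast+
    finally show "(\<Sum>D\<in>Ps. if t \<in> ?D D then 1 else 0) \<le> card Ps - 1"
      using card_Diff_singleton[OF D(1)] by simp
  qed
  finally show ?thesis by (simp add: mult.commute)
qed

definition rate :: real where "rate = 1 - 1 / real (card Ps)"

lemma rate: "0 < rate" "rate < 1"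
proof -
  obtain D where D: "D \<in> Ps" using Ps_nonempty by blast
  obtain D' where "D' \<in> Ps" "D' \<noteq> D" by (rule Ps_two[OF D])
  then have "card {D, D'} \<le> card Ps" "card {D, D'} = 2"
    using card_mono[OF finite_Ps, of "{D, D'}"] D by auto
  then have "card Ps \<ge> 2" by simp
  then show "0 < rate" "rate < 1" by (auto simp: rate_def field_simps)
qed

lemma inward_decay:
  assumes W: "\<And>u. W u \<in> S"
  shows "real (card (traversal_starts W n (pal_line L {}) 1 (int (C ^ k) + 1))) \<le> rate ^ k * real n"
proof (induction k)
  case 0
  then show ?case using card_traversal_starts_le by simp
next
  case (Suc k)
  let ?I = "\<lambda>k. real (card (traversal_starts W n (pal_line L {}) 1 (int (C ^ k) + 1)))"
  have p: "card Ps > 0" using Ps_nonempty finite_Ps by (simp add: card_gt_0_iff)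
  have "1 \<le> C ^ k" by (rule one_le_power) (use C_pos in linarith)
  from inward_contract[where W=W and r="C ^ k" and n=n, OF W this]
  have "card Ps * card (traversal_starts W n (pal_line L {}) 1 (int (C ^ Suc k) + 1))
     \<le> (card Ps - 1) * card (traversal_starts W n (pal_line L {}) 1 (int (C ^ k) + 1))"
    by (simp only: power_Suc)
  then have "real (card Ps * card (traversal_starts W n (pal_line L {}) 1 (int (C ^ Suc k) + 1)))
     \<le> real ((card Ps - 1) * card (traversal_starts W n (pal_line L {}) 1 (int (C ^ k) + 1)))"
    by (simp only: of_nat_le_iff)
  then have "real (card Ps) * ?I (Suc k) \<le> (real (card Ps) - 1) * ?I k"
    using p by (simp only: of_nat_mult of_nat_diff Suc_leI One_nat_def of_nat_Suc of_nat_0 add_0_right)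
  then have "?I (Suc k) \<le> rate * ?I k" using p by (simp add: rate_def field_simps)
  also have "\<dots> \<le> rate * (rate ^ k * real n)" using Suc rate by (intro mult_left_mono) auto
  finally show ?case by simp
qed

end

section \<open>Coding of words\<close>

text \<open>Lists of length exactly \<open>m\<close> cover these sets, with \<open>None\<close> as
  padding.\<close>

lemma card_subsets_le:
  assumes "finite \<Omega>"
  shows "finite {B. B \<subseteq> \<Omega> \<and> card B \<le> m}" "card {B. B \<subseteq> \<Omega> \<and> card B \<le> m} \<le> (card \<Omega> + 1) ^ m"
proof -
  let ?X = "{xs. set xs \<subseteq> insert None (Some ` \<Omega>) \<and> length xs = m}"
  have sub: "{B. B \<subseteq> \<Omega> \<and> card B \<le> m} \<subseteq> (\<lambda>xs. {x. Some x \<in> set xs}) ` ?X"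
  proof
    fix B assume B: "B \<in> {B. B \<subseteq> \<Omega> \<and> card B \<le> m}"
    then have "finite B" using assms finite_subset by auto
    then obtain ys where ys: "set ys = B" "distinct ys" using finite_distinct_list by blast
    then have l: "length ys \<le> m" using B distinct_card by fastforce
    let ?xs = "map Some ys @ replicate (m - length ys) None"
    have "?xs \<in> ?X" using l ys B by auto
    moreover have "B = {x. Some x \<in> set ?xs}" using ys by auto
    ultimately show "B \<in> (\<lambda>xs. {x. Some x \<in> set xs}) ` ?X" by blast
  qed
  have fin: "finite ?X" using assms by (intro finite_lists_length_eq) auto
  have cX: "card ?X = (card \<Omega> + 1) ^ m"
    using assms by (subst card_lists_length_eq) (auto simp: card_image)
  show "finite {B. B \<subseteq> \<Omega> \<and> card B \<le> m}" by (rule finite_surj[OF fin sub])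
  show "card {B. B \<subseteq> \<Omega> \<and> card B \<le> m} \<le> (card \<Omega> + 1) ^ m"
    using surj_card_le[OF fin sub] cX by simp
qed

text \<open>Each vertex lies on exactly one even edge, the one labelled by elements of
  \<open>A\<close>; only even edges are marked.\<close>

definition a_edge :: "int \<Rightarrow> int" where "a_edge v = (if even v then v else v - 1)"

text \<open>Stands for the group element of a word: \<open>restrict\<close> makes equality mean
  equal effect on vertex 0 of every line in \<open>Ls\<close>, and every vertex is vertex 0 of a
  recentred line.\<close>

definition (in line_system) endpoints :: "nat \<Rightarrow> (nat \<Rightarrow> 's) \<Rightarrow> (int \<Rightarrow> 's set) \<Rightarrow> int" where
  "endpoints n W = restrict (\<lambda>E. walk W E 0 0 n) Ls"

locale line_coding = line_system S Ls L Ps K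
  for S :: "'s set" and Ls :: "(int \<Rightarrow> 's set) set" and L Ps K +
  fixes D :: "'s set" and r n :: nat
  assumes DPs: "D \<in> Ps" and r: "r \<ge> 1"
begin

text \<open>The factor \<open>C\<close> is that of \<open>pal_separated\<close>: palindromes of this
  radius have centres more than \<open>r + 1\<close> apart.\<close>

definition \<rho> :: nat where "\<rho> = C * (r + 1)"

text \<open>Twice the reach of \<open>pal_near\<close> and some room: there are marks within this
  distance on both sides of vertex 0.\<close>

definition R1 :: nat where "R1 = 2 * K * (\<rho> + 1) + 4"

text \<open>A window of this radius shows which vertices within \<open>R1\<close> are marked and how
  letters move them.\<close>

definition R :: nat where "R = R1 + \<rho> + 2"

definition marked :: "(int \<Rightarrow> 's set) \<Rightarrow> int \<Rightarrow> bool" where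
  "marked E v \<longleftrightarrow> (\<forall>j. \<bar>j\<bar> \<le> int \<rho> \<longrightarrow> E (a_edge v + j) = pal_line L D j)"

definition local_type :: "(int \<Rightarrow> 's set) \<Rightarrow> int \<Rightarrow> 's set" where
  "local_type E j = (if - int R \<le> j \<and> j < int R then E j else {})"

text \<open>Lines are viewed from the current vertex, so a walk that starts at a mark has it as edge
  0, and returning to this edge is not an arrival. The search stops at the end \<open>n\<close> of
  the word.\<close>

definition next_len :: "(nat \<Rightarrow> 's) \<Rightarrow> (int \<Rightarrow> 's set) \<Rightarrow> nat \<Rightarrow> nat" where
  "next_len W E t = (LEAST k. n \<le> t + k \<or> 
     marked E (walk W E t 0 k) \<and> a_edge (walk W E t 0 k) \<noteq> 0)"

definition next_pos :: "(nat \<Rightarrow> 's) \<Rightarrow> (int \<Rightarrow> 's set) \<Rightarrow> nat \<Rightarrow> int" where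
  "next_pos W E t = walk W E t 0 (next_len W E t)"

lemma marked_recenter0: "marked (recenter E v) 0 \<longleftrightarrow> marked E v"
proof (cases "even v")
  case False
  have "recenter E v j = E (a_edge v + - j)" for j
    using False by (simp add: recenter_def a_edge_def algebra_simps)
  then have "marked (recenter E v) 0 \<longleftrightarrow> (\<forall>j. \<bar>j\<bar> \<le> int \<rho> \<longrightarrow> E (a_edge v + - j) = pal_line L D (- j))"
    by (simp add: marked_def pal_line_minus a_edge_def)
  also have "\<dots> \<longleftrightarrow> marked E v"
    unfolding marked_def by (metis abs_minus_cancel minus_minus)
  finally show ?thesis .
qed (simp add: marked_def recenter_def a_edge_def)

lemma marked_recenter: "marked (recenter E v) w \<longleftrightarrow> marked E (chart v w)"
  by (metis marked_recenter0 recenter_recenter)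

lemma marked_apart:
  assumes "marked E v" "marked E w" "a_edge v < a_edge w"
  shows "a_edge v + int r + 2 \<le> a_edge w"
proof -
  have "int \<rho> < int C * (a_edge w - a_edge v)"
    using pal_separated[OF DPs, of \<rho> E "a_edge v" "a_edge w"] assms unfolding marked_def by blast
  then have "int C * (int r + 1) < int C * (a_edge w - a_edge v)" by (simp add: \<rho>_def algebra_simps)
  then have "int r + 1 < a_edge w - a_edge v" by (simp add: mult_less_cancel_left)
  then show ?thesis by simp
qed

lemma next_len_cond:
  "n \<le> t + next_len W E t \<or> 
     marked E (next_pos W E t) \<and> a_edge (next_pos W E t) \<noteq> 0"
  unfolding next_len_def next_pos_def by (rule LeastI[of _ n]) simp

lemma next_len_less:
  "k < next_len W E t \<Longrightarrow> t + k < n \<and>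
     \<not> (marked E (walk W E t 0 k) \<and> a_edge (walk W E t 0 k) \<noteq> 0)"
  using not_less_Least[of k "\<lambda>k. n \<le> t + k \<or> marked E (walk W E t 0 k) \<and> a_edge (walk W E t 0 k) \<noteq> 0"]
  unfolding next_len_def by auto

lemma next_len_le: "t \<le> n \<Longrightarrow> t + next_len W E t \<le> n"
proof -
  assume t: "t \<le> n"
  then have "next_len W E t \<le> n - t" unfolding next_len_def by (intro Least_le) simp
  then show "t + next_len W E t \<le> n" using t by simp
qed

lemma next_len_pos: "t < n \<Longrightarrow> next_len W E t > 0"
  using next_len_cond[of t W E] by (auto simp: next_pos_def a_edge_def intro: gr0I)

text \<open>There are marks on both sides of the start, and a walk with steps of length at most 1
  cannot pass a mark without arriving there.\<close>

lemma confined: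
  assumes E: "E \<in> Ls" and k: "k \<le> next_len W E t"
  shows "\<bar>walk W E t 0 k\<bar> \<le> int R1"
proof -
  let ?p = "walk W E t 0"
  \<comment> \<open>The error of \<open>pal_near\<close> is at most \<open>b - 1\<close>, so the
    marks found near \<open>b\<close> and \<open>- b\<close> lie strictly on opposite sides of
    0.\<close>
  define b where "b = int K * (int \<rho> + 1) + 2"
  have "\<rho> \<ge> 1" using C_pos by (simp add: \<rho>_def)
  obtain c where c: "even c" "\<bar>c - b\<bar> \<le> int K * (int \<rho> + 1) + 1" "\<And>j. \<bar>j\<bar> \<le> int \<rho> \<Longrightarrow> E (c + j) = pal_line L D j"
    using pal_near[OF E DPs \<open>\<rho> \<ge> 1\<close>] by metis
  obtain c' where c': "even c'" "\<bar>c' - (- b)\<bar> \<le> int K * (int \<rho> + 1) + 1" "\<And>j. \<bar>j\<bar> \<le> int \<rho> \<Longrightarrow> E (c' + j) = pal_line L D j"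
    using pal_near[OF E DPs \<open>\<rho> \<ge> 1\<close>] by metis
  have R1: "int R1 = 2 * (int K * (int \<rho> + 1)) + 4" by (simp add: R1_def algebra_simps)
  have cb: "0 < c" "c \<le> int R1" "c' < 0" "- int R1 \<le> c'"
    using c(2) c'(2) unfolding R1 b_def by linarith+
  have m: "marked E c" "marked E c'" using c c' by (auto simp: marked_def a_edge_def)
  have no: "?p j \<noteq> c" "?p j \<noteq> c'" if "j < k" for j
    using next_len_less[of j W E t] that k m c(1) c'(1) cb by (auto simp: a_edge_def)
  have "?p k \<le> c"
  proof (rule ccontr)
    assume ab: "\<not> ?thesis"
    then obtain j where "j \<le> k" "?p j = c" using walk_ivt_up[of 0 c W E t k] cb by force
    then show False using no[of j] ab by (cases "j = k") auto
  qed
  moreover have "c' \<le> ?p k"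
  proof (rule ccontr)
    assume ab: "\<not> ?thesis"
    then obtain j where "j \<le> k" "?p j = c'" using walk_ivt_down[of c' 0 W E t k] cb by force
    then show False using no[of j] ab by (cases "j = k") auto
  qed
  ultimately show ?thesis using cb by linarith
qed

lemma next_cong:
  assumes E: "E \<in> Ls" and eq: "local_type E = local_type E'"
  shows "next_len W E' t = next_len W E t" "next_pos W E' t = next_pos W E t"
proof -
  let ?p = "walk W E t 0" and ?q = "walk W E' t 0" and ?k = "next_len W E t"
  have EE: "E' j = E j" if "- int R \<le> j" "j < int R" for j
    using fun_cong[OF eq, of j] that by (simp add: local_type_def)
  have pq: "k \<le> ?k \<Longrightarrow> ?q k = ?p k" for k
  proof (induction k)
    case (Suc k)
    then have "\<bar>?p k\<bar> \<le> int R1" using confined[OF E, of k] by simp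
    then have "E' (?p k) = E (?p k)" "E' (?p k - 1) = E (?p k - 1)"
      by (auto simp: R_def intro!: EE)
    then show ?case using Suc by (simp add: step_def)
  qed simp
  have mk: "marked E' (?p k) \<longleftrightarrow> marked E (?p k)" if "k \<le> ?k" for k
  proof -
    have "\<bar>?p k\<bar> \<le> int R1" using confined[OF E that] .
    then have "E' (a_edge (?p k) + j) = E (a_edge (?p k) + j)" if "\<bar>j\<bar> \<le> int \<rho>" for j
      using that by (intro EE) (auto simp: R_def a_edge_def)
    then show ?thesis by (simp add: marked_def)
  qed
  show 1: "next_len W E' t = ?k"
    unfolding next_len_def[of W E']
  proof (rule Least_equality)
    show "n \<le> t + ?k \<or> marked E' (?q ?k) \<and> a_edge (?q ?k) \<noteq> 0"
      using next_len_cond[of t W E] pq[of ?k] mk[of ?k] by (simp add: next_pos_def)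
    fix k assume k: "n \<le> t + k \<or> marked E' (?q k) \<and> a_edge (?q k) \<noteq> 0"
    show "?k \<le> k"
    proof (rule ccontr)
      assume "\<not> ?k \<le> k"
      then show False using k next_len_less[of k W E t] pq[of k] mk[of k] by auto
    qed
  qed
  show "next_pos W E' t = next_pos W E t" unfolding next_pos_def 1 using pq by simp
qed

definition arrivals :: "(nat \<Rightarrow> 's) \<Rightarrow> nat set" where
  "arrivals W = {t + next_len W E t | E t. E \<in> Ls \<and> t \<le> n \<and> (t = 0 \<or> marked E 0)}"

text \<open>The graph of the map from a pattern and a time to the displacement and duration up to
  the next mark.\<close>

definition code :: "(nat \<Rightarrow> 's) \<Rightarrow> (((int \<Rightarrow> 's set) \<times> nat) \<times> (int \<times> nat)) set" where
  "code W = {((local_type E, t), (next_pos W E t, next_len W E t)) | E t. E \<in> Ls \<and> t \<le> n \<and>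
     (t = 0 \<or> marked E 0 \<and> t \<in> arrivals W)}"

section \<open>Reconstruction of a walk from the code\<close>

lemma walk_next:
  assumes "E \<in> Ls" "t \<le> n"
  shows "walk W E t 0 (n - t) = chart (next_pos W E t)
     (walk W (recenter E (next_pos W E t)) (t + next_len W E t) 0 (n - (t + next_len W E t)))"
proof -
  have "n - t = next_len W E t + (n - (t + next_len W E t))" using next_len_le[OF assms(2), of W E] by simp
  then have "walk W E t 0 (n - t) = walk W E (t + next_len W E t) (next_pos W E t) (n - (t + next_len W E t))"
    by (metis walk_add next_pos_def)
  also have "next_pos W E t = chart (next_pos W E t) 0" by (simp add: chart_def)
  finally show ?thesis using walk_recenter[OF disj[OF assms(1)]] by metis
qed

text \<open>Induction on the remaining time: the code tells where and when the next mark is reached,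
  and there the line seen from the new vertex is again covered, because this time is an
  arrival.\<close>

lemma code_inj:
  assumes c: "code W = code W'"
  shows "E \<in> Ls \<Longrightarrow> t \<le> n \<Longrightarrow> t = 0 \<or> marked E 0 \<and> t \<in> arrivals W \<Longrightarrow>
    walk W E t 0 (n - t) = walk W' E t 0 (n - t)"
proof (induction "n - t" arbitrary: E t rule: less_induct)
  case less
  show ?case
  proof (cases "t = n")
    case False
    then have "t < n" using less by simp
    have "((local_type E, t), (next_pos W E t, next_len W E t)) \<in> code W"
      unfolding code_def using less.prems by blast
    then have "((local_type E, t), (next_pos W E t, next_len W E t)) \<in> code W'"
      by (simp only: c)
    \<comment> \<open>The entry in the second code may come from another line, but one of the same
      local type, which continues in the same way.\<close>
    then obtain E' where E': "local_type E = local_type E'" "next_pos W E t = next_pos W' E' t"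
      "next_len W E t = next_len W' E' t" unfolding code_def by blast
    then have nx: "next_pos W' E t = next_pos W E t" "next_len W' E t = next_len W E t"
      using next_cong[OF less.prems(1) E'(1), of W' t] by auto
    let ?v = "next_pos W E t" and ?t = "t + next_len W E t"
    have le: "?t \<le> n" using next_len_le less.prems by blast
    have "walk W (recenter E ?v) ?t 0 (n - ?t) = walk W' (recenter E ?v) ?t 0 (n - ?t)"
    proof (cases "?t = n")
      case False
      then have "marked (recenter E ?v) 0" using next_len_cond[of t W E] le by (simp add: marked_recenter0)
      moreover have "?t \<in> arrivals W" unfolding arrivals_def using less.prems by blast
      moreover have "n - ?t < n - t" using next_len_pos[OF \<open>t < n\<close>, of W E] \<open>t < n\<close> by linarith
      ultimately show ?thesis using less.hyps[of ?t "recenter E ?v"] recenter_in less.prems(1) le by blast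
    qed simp
    then show ?thesis
      using walk_next[OF less.prems(1,2), of W] walk_next[OF less.prems(1,2), of W'] nx by simp
  qed simp
qed

abbreviation inward :: "(nat \<Rightarrow> 's) \<Rightarrow> nat set" where
  "inward W \<equiv> traversal_starts W n (pal_line L {}) 1 (int r + 1)"

text \<open>Distinct marked edges are more than \<open>r\<close> apart, so the walk arrives through a full one-sided palindrome.\<close>

lemma arrival_crossing:
  assumes E: "E \<in> Ls" and m: "marked E 0" and t: "t + next_len W E t < n"
  obtains t1 k1 where "traversal W (pal_line L {}) 1 (int r + 1) t1 k1" "t1 + k1 = t + next_len W E t"
proof -
  let ?k = "next_len W E t"
  define v where "v = next_pos W E t"
  have v: "marked E v" "a_edge v \<noteq> 0" using next_len_cond[of t W E] t by (auto simp: v_def)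
  \<comment> \<open>The other end of the mark that is reached. Seen from it, the mark is edge 0, the
    arrival is at vertex 1 and the walk starts at \<open>p0\<close>.\<close>
  define v' where "v' = (if even v then v + 1 else v - 1)"
  define p0 where "p0 = (if even v' then - v' else v')"
  define F where "F = recenter E v'"
  define q where "q = walk W F t p0"
  have ch: "chart v' 1 = v" "chart v' p0 = 0" "chart v' 0 = v'" by (auto simp: chart_def v'_def p0_def)
  have ev: "a_edge v' = a_edge v" by (auto simp: a_edge_def v'_def)
  have v'm: "marked E v'" using v(1) by (simp add: marked_def ev)
  have pq: "walk W E t 0 k = chart v' (q k)" for k
    using walk_recenter[OF disj[OF E], of W t v' p0 k] by (simp add: ch q_def F_def)
  have ci: "chart v' x = chart v' y \<longleftrightarrow> x = y" for x y by (auto simp: chart_def)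
  have qk: "q ?k = 1" using pq[of ?k] ch(1) ci by (metis v_def next_pos_def)
  have qn: "q k \<noteq> 0" "q k \<noteq> 1" if "k < ?k" for k
    using next_len_less[OF that] pq[of k] v v'm ev ch by auto
  have kpos: "?k > 0" using next_len_pos t by simp
  have p0: "p0 \<noteq> 0" "p0 \<noteq> 1" using qn[OF kpos] by (auto simp: q_def)
  have e0: "a_edge p0 \<noteq> 0" using p0 by (auto simp: a_edge_def)
  have mF: "marked F 0" "marked F p0" using marked_recenter ch v'm m by (auto simp: F_def)
  \<comment> \<open>A walk from below would reach vertex 0 before vertex 1, and that would already
    be an arrival.\<close>
  have "p0 > 0"
  proof (rule ccontr)
    assume "\<not> p0 > 0"
    then obtain k where "k \<le> ?k" "q k = 0" using walk_ivt_up[of p0 0 W F t ?k] qk by (auto simp: q_def)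
    then show False using qn[of k] qk by (cases "k = ?k") auto
  qed
  then have "a_edge p0 > a_edge 0" using e0 by (auto simp: a_edge_def)
  from marked_apart[OF mF this] have "int r + 1 \<le> p0" by (auto simp: a_edge_def split: if_splits)
  moreover have "walk W F t p0 ?k \<le> 1" "1 < int r + 1" using qk r by (auto simp: q_def)
  ultimately obtain j k' where j: "j + k' \<le> ?k" "walk W F t p0 j = int r + 1" "traversal W F 1 (int r + 1) (t + j) k'"
    using traversal_crossing by blast
  have "q (j + k') = 1" using j(2,3) walk_add[of W F t p0 j k'] by (simp add: q_def traversal_def)
  then have jk: "j + k' = ?k" using qn[of "j + k'"] j(1) by force
  have dF: "disj_line F" unfolding F_def by (intro disj_line_recenter disj E)
  have "1 * (r + 1) \<le> \<rho>" unfolding \<rho>_def using C_pos by (intro mult_right_mono) auto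
  then have "r \<le> \<rho>" by simp
  have "traversal W (pal_line L {}) (0 + 1) (0 + (int r + 1)) (t + j) k'"
  proof (rule traversal_shift[OF dF disj_pal_empty _ j(3)])
    fix i assume "1 \<le> i" "i < int r + 1"
    then have "F (a_edge 0 + i) = pal_line L D i" using mF(1) \<open>r \<le> \<rho>\<close> unfolding marked_def by auto
    then show "pal_line L {} (0 + i) = F i" using \<open>1 \<le> i\<close> by (simp add: a_edge_def pal_line_def)
  qed (use r in simp)
  then show ?thesis using that[of "t + j" k'] jk by simp
qed

section \<open>Counting local patterns and codes\<close>

definition types :: "(int \<Rightarrow> 's set) set" where "types = local_type ` Ls"
definition marked_types :: "(int \<Rightarrow> 's set) set" where "marked_types = local_type ` {E \<in> Ls. marked E 0}"

definition c0 :: nat where "c0 = 2 * K * C + 2 * K + C + 6"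

lemma R_le: "R \<le> c0 * (r + 1)"
  by (simp add: R_def R1_def \<rho>_def c0_def algebra_simps)

text \<open>Reduces the counting of patterns to the counting of vertices in an interval of one fixed
  line.\<close>

lemma types_from_line:
  assumes E0: "E0 \<in> Ls" and E: "E \<in> Ls"
  obtains c where "\<bar>c\<bar> \<le> int K * int R" "local_type E = local_type (recenter E0 c)" 
    "marked E 0 \<longleftrightarrow> marked E0 c"
proof -
  have "R \<ge> 2" by (simp add: R_def)
  then obtain c where c: "\<bar>c\<bar> \<le> int K * int R"
     "\<forall>j. - int R \<le> j \<and> j < int R \<longrightarrow> recenter E0 c j = E j"
    using repetitive[of R E E0] E0 E by blast
  have "recenter E0 c j = E j" if "\<bar>j\<bar> \<le> int \<rho>" for j
  proof -
    have "- int R \<le> j \<and> j < int R" using that by (auto simp: R_def)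
    then show ?thesis using c(2) by blast
  qed
  then have "marked E 0 \<longleftrightarrow> marked E0 c"
    unfolding marked_recenter0[of E0 c, symmetric] by (simp add: marked_def a_edge_def)
  moreover have "local_type E = local_type (recenter E0 c)" using c(2) by (simp add: local_type_def fun_eq_iff)
  ultimately show ?thesis using that[of c] c(1) by blast
qed

lemma card_types: "finite types" "card types \<le> 2 * K * R + 1"
proof -
  obtain E0 where E0: "E0 \<in> Ls" using realized[OF DPs] by blast
  let ?X = "{- (int K * int R) .. int K * int R}"
  have sub: "types \<subseteq> (\<lambda>c. local_type (recenter E0 c)) ` ?X"
  proof
    fix q assume "q \<in> types"
    then obtain E where E: "E \<in> Ls" "q = local_type E" by (auto simp: types_def)
    obtain c where "\<bar>c\<bar> \<le> int K * int R" "local_type E = local_type (recenter E0 c)"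
      by (rule types_from_line[OF E0 E(1)])
    moreover from this have "c \<in> ?X" by auto
    ultimately show "q \<in> (\<lambda>c. local_type (recenter E0 c)) ` ?X" using E by blast
  qed
  have X: "finite ?X" "card ?X = 2 * K * R + 1" by (auto simp: nat_eq_iff)
  show "finite types" by (rule finite_surj[OF X(1) sub])
  show "card types \<le> 2 * K * R + 1" using surj_card_le[OF X(1) sub] X(2) by simp
qed

text \<open>The bound is independent of \<open>r\<close>: the interval has length proportional to
  \<open>r + 1\<close>, and a block of length \<open>r + 1\<close> contains at most one mark. The
  parity of \<open>c\<close> distinguishes the two ends of the mark.\<close>

lemma card_marked_types: "finite marked_types" "card marked_types \<le> 4 * (K * c0 + 1)"
proof -
  obtain E0 where E0: "E0 \<in> Ls" using realized[OF DPs] by blast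
  let ?X = "{c. \<bar>c\<bar> \<le> int K * int R \<and> marked E0 c}"
  have sub: "marked_types \<subseteq> (\<lambda>c. local_type (recenter E0 c)) ` ?X"
  proof
    fix q assume "q \<in> marked_types"
    then obtain E where E: "E \<in> Ls" "marked E 0" "q = local_type E" by (auto simp: marked_types_def)
    obtain c where "\<bar>c\<bar> \<le> int K * int R" "local_type E = local_type (recenter E0 c)" "marked E 0 \<longleftrightarrow> marked E0 c"
      by (rule types_from_line[OF E0 E(1)])
    then show "q \<in> (\<lambda>c. local_type (recenter E0 c)) ` ?X" using E by blast
  qed
  have fin: "finite ?X" by (rule finite_subset[of _ "{- (int K * int R) .. int K * int R}"]) auto
  let ?f = "\<lambda>c. (a_edge c div (int r + 1), even c)"
  have nlt: "\<not> a_edge c < a_edge c'" if "marked E0 c" "marked E0 c'"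
    "a_edge c div (int r + 1) = a_edge c' div (int r + 1)" for c c'
  proof
    assume "a_edge c < a_edge c'"
    then have "a_edge c + (int r + 1) \<le> a_edge c'" using marked_apart[OF that(1,2)] by simp
    then have "(a_edge c + (int r + 1)) div (int r + 1) \<le> a_edge c' div (int r + 1)"
      by (intro zdiv_mono1) auto
    moreover have "(a_edge c + (int r + 1)) div (int r + 1) = a_edge c div (int r + 1) + 1" by simp
    ultimately show False using that by simp
  qed
  have inj: "inj_on ?f ?X"
  proof (rule inj_onI)
    fix c c' assume a: "c \<in> ?X" "c' \<in> ?X" "?f c = ?f c'"
    then have "a_edge c = a_edge c'" using nlt[of c c'] nlt[of c' c] by force
    then show "c = c'" using a by (auto simp: a_edge_def split: if_splits)
  qed
  have "?f ` ?X \<subseteq> {- int (K * c0) - 1 .. int (K * c0)} \<times> UNIV"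
  proof (rule image_subsetI)
    fix c assume "c \<in> ?X"
    then have c: "\<bar>c\<bar> \<le> int K * int R" by simp
    have "int K * int R \<le> int K * (int c0 * (int r + 1))" 
      using R_le by (intro mult_left_mono) (auto simp flip: of_nat_mult of_nat_Suc simp: add.commute)
    then have *: "int K * int R \<le> int (K * c0) * (int r + 1)" by (simp add: mult.assoc)
    have "a_edge c \<le> int (K * c0) * (int r + 1)" using c * by (auto simp: a_edge_def)
    then have "a_edge c div (int r + 1) \<le> (int (K * c0) * (int r + 1)) div (int r + 1)"
      by (intro zdiv_mono1) auto
    moreover have "(- int (K * c0) - 1) * (int r + 1) \<le> a_edge c"
      using c * by (auto simp: a_edge_def left_diff_distrib)
    then have "((- int (K * c0) - 1) * (int r + 1)) div (int r + 1) \<le> a_edge c div (int r + 1)"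
      by (intro zdiv_mono1) auto
    ultimately show "(a_edge c div (int r + 1), even c) \<in> {- int (K * c0) - 1 .. int (K * c0)} \<times> UNIV"
      by simp
  qed
  then have "card ?X \<le> card ({- int (K * c0) - 1 .. int (K * c0)} \<times> (UNIV :: bool set))"
    by (intro card_inj_on_le[OF inj]) auto
  also have "\<dots> = 4 * (K * c0 + 1)" by (simp add: card_cartesian_product nat_add_distrib nat_mult_distrib)
  finally show "card marked_types \<le> 4 * (K * c0 + 1)" using surj_card_le[OF fin sub] by linarith
  show "finite marked_types" by (rule finite_surj[OF fin sub])
qed

text \<open>By \<open>next_cong\<close> one line per local type gives all continuations, so the code
  is contained in the image of a set of pairs of a type and a time.\<close>

definition rep :: "(int \<Rightarrow> 's set) \<Rightarrow> int \<Rightarrow> 's set" where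
  "rep q = (SOME E. E \<in> Ls \<and> local_type E = q)"

lemma next_rep:
  assumes "E \<in> Ls"
  shows "next_len W E t = next_len W (rep (local_type E)) t" "next_pos W E t = next_pos W (rep (local_type E)) t"
proof -
  have "rep (local_type E) \<in> Ls \<and> local_type (rep (local_type E)) = local_type E" unfolding rep_def by (rule someI[of _ E]) (simp add: assms)
  then show "next_len W E t = next_len W (rep (local_type E)) t" "next_pos W E t = next_pos W (rep (local_type E)) t"
    using next_cong[of "rep (local_type E)" E W t] by auto
qed

text \<open>The summands are the arrivals of walks begun at time 0, one for each local type; the end
  \<open>n\<close> of the word; and the earlier arrivals from marked starts, each determined by the
  start of the passage that it ends.\<close>

lemma card_arrivals: "finite (arrivals W)" "card (arrivals W) \<le> card types + 1 + card (inward W)"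
proof -
  let ?A = "(\<lambda>q. next_len W (rep q) 0) ` types" and
    ?B = "(\<lambda>t. t + (THE k. traversal W (pal_line L {}) 1 (int r + 1) t k)) ` inward W"
  have sub: "arrivals W \<subseteq> ?A \<union> {n} \<union> ?B"
  proof
    fix t' assume "t' \<in> arrivals W"
    then obtain E t where E: "E \<in> Ls" "t \<le> n" "t = 0 \<or> marked E 0" "t' = t + next_len W E t"
      by (auto simp: arrivals_def)
    have "t' \<le> n" using next_len_le E by simp
    show "t' \<in> ?A \<union> {n} \<union> ?B"
    proof (cases "t = 0 \<or> t' = n")
      case True
      then show ?thesis using E next_rep[OF E(1)] by (auto simp: types_def)
    next
      case False
      then obtain t1 k1 where k1: "traversal W (pal_line L {}) 1 (int r + 1) t1 k1" "t1 + k1 = t'"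
        using arrival_crossing[OF E(1), of t W] E \<open>t' \<le> n\<close> by auto
      then have "(THE k. traversal W (pal_line L {}) 1 (int r + 1) t1 k) = k1"
        by (intro the_equality) (auto intro: traversal_unique)
      moreover have "t1 \<in> inward W" using k1 \<open>t' \<le> n\<close> by (auto simp: traversal_starts_def)
      ultimately show ?thesis using k1(2) by force
    qed
  qed
  have fin: "finite ?A" "finite ?B" using card_types by auto
  then show "finite (arrivals W)" using sub finite_subset by blast
  have "card (arrivals W) \<le> card (?A \<union> {n} \<union> ?B)" using fin sub by (intro card_mono) auto
  also have "\<dots> \<le> card ?A + card {n} + card ?B"
    using card_Un_le[of "?A \<union> {n}" ?B] card_Un_le[of ?A "{n}"] by linarith
  also have "\<dots> \<le> card types + 1 + card (inward W)"
    using card_image_le[OF card_types(1), of "\<lambda>q. next_len W (rep q) 0"]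
      card_image_le[of "inward W" "\<lambda>t. t + (THE k. traversal W (pal_line L {}) 1 (int r + 1) t k)"] by simp
  finally show "card (arrivals W) \<le> card types + 1 + card (inward W)" .
qed

lemma card_code: "card (code W) \<le> card types + 4 * (K * c0 + 1) * (card types + 1 + card (inward W))"
proof -
  let ?f = "\<lambda>(q, t). ((q, t), (next_pos W (rep q) t, next_len W (rep q) t))"
  have sub: "code W \<subseteq> ?f ` (types \<times> {0} \<union> marked_types \<times> arrivals W)"
  proof
    fix x assume "x \<in> code W"
    then obtain E t where E: "E \<in> Ls" "t = 0 \<or> marked E 0 \<and> t \<in> arrivals W"
      and x: "x = ((local_type E, t), (next_pos W E t, next_len W E t))" unfolding code_def by blast
    have "x = ?f (local_type E, t)" using x next_rep[OF E(1)] by simp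
    moreover have "(local_type E, t) \<in> types \<times> {0} \<union> marked_types \<times> arrivals W" using E by (auto simp: types_def marked_types_def)
    ultimately show "x \<in> ?f ` (types \<times> {0} \<union> marked_types \<times> arrivals W)" by blast
  qed
  have fin: "finite (types \<times> {0::nat} \<union> marked_types \<times> arrivals W)" using card_types card_marked_types card_arrivals by auto
  have "card (code W) \<le> card (types \<times> {0::nat} \<union> marked_types \<times> arrivals W)" by (rule surj_card_le[OF fin sub])
  also have "\<dots> \<le> card types + card marked_types * card (arrivals W)"
    using card_Un_le[of "types \<times> {0::nat}" "marked_types \<times> arrivals W"] by (simp add: card_cartesian_product)
  also have "\<dots> \<le> card types + 4 * (K * c0 + 1) * (card types + 1 + card (inward W))"
    using card_marked_types card_arrivals by (intro add_left_mono mult_mono) auto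
  finally show ?thesis .
qed

definition \<Omega> :: "(((int \<Rightarrow> 's set) \<times> nat) \<times> (int \<times> nat)) set" where
  "\<Omega> = (types \<times> {..n}) \<times> ({- int R1..int R1} \<times> {..n})"

lemma card_\<Omega>: "finite \<Omega>" "card \<Omega> \<le> (2 * K * R + 1) * (2 * R + 1) * (n + 1) ^ 2"
proof -
  show "finite \<Omega>" using card_types by (simp add: \<Omega>_def)
  have "card \<Omega> = (card types * (n + 1)) * ((2 * R1 + 1) * (n + 1))"
    by (simp add: \<Omega>_def card_cartesian_product nat_add_distrib nat_mult_distrib)
  also have "\<dots> \<le> ((2 * K * R + 1) * (n + 1)) * ((2 * R + 1) * (n + 1))"
    using card_types by (intro mult_mono) (auto simp: R_def)
  finally show "card \<Omega> \<le> (2 * K * R + 1) * (2 * R + 1) * (n + 1) ^ 2"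
    by (simp add: power2_eq_square algebra_simps)
qed

lemma code_sub: "code W \<subseteq> \<Omega>"
proof
  fix x assume "x \<in> code W"
  then obtain E t where E: "E \<in> Ls" "t \<le> n" 
      and x: "x = ((local_type E, t), (next_pos W E t, next_len W E t))" unfolding code_def by blast
  have "\<bar>next_pos W E t\<bar> \<le> int R1" using confined[OF E(1), of "next_len W E t"] by (simp add: next_pos_def)
  moreover have "next_len W E t \<le> n" using next_len_le[OF E(2), of W E] by simp
  ultimately show "x \<in> \<Omega>" using E x by (auto simp: \<Omega>_def types_def)
qed

text \<open>A word is replaced by its code, a small set of entries from \<Omega>, whose size is
  polynomial in \<open>R\<close> and \<open>n\<close>.\<close>

lemma card_endpoints:
  assumes I: "\<And>W. (\<And>u. W u \<in> S) \<Longrightarrow> card (inward W) \<le> I"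
  defines "x \<equiv> 2 * (K + 1) * R + 1"
  shows "finite (endpoints n ` {W. \<forall>u. W u \<in> S})"
    "card (endpoints n ` {W. \<forall>u. W u \<in> S}) \<le> (x ^ 2 * (n + 1) ^ 2 + 1) ^ (x + 4 * (K * c0 + 1) * (x + 1 + I))"
proof -
  let ?W = "{W. \<forall>u. W u \<in> S}" and ?m = "x + 4 * (K * c0 + 1) * (x + 1 + I)"
  have Qx: "card types \<le> x" using card_types by (simp add: x_def)
  have "card (code W) \<le> ?m" if "W \<in> ?W" for W
  proof -
    have "card (inward W) \<le> I" using that I by simp
    then have "card types + 4 * (K * c0 + 1) * (card types + 1 + card (inward W)) \<le> ?m"
      using Qx by (intro add_mono mult_left_mono) auto
    then show ?thesis using card_code[of W] by linarith
  qed
  then have sub: "code ` ?W \<subseteq> {B. B \<subseteq> \<Omega> \<and> card B \<le> ?m}" using code_sub by blast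
  have fin: "finite (code ` ?W)" using card_subsets_le(1)[OF card_\<Omega>(1)] sub by (rule finite_subset[rotated])
  have "endpoints n W = endpoints n W'" if "code W = code W'" for W W'
    using code_inj[OF that, of _ 0] unfolding endpoints_def by (auto simp: restrict_def)
  then have ex: "\<exists>g. \<forall>W. endpoints n W = g (code W)"
    by (intro exI[of _ "\<lambda>c. endpoints n (SOME W. code W = c)"]) (metis (mono_tags, lifting) someI_ex)
  then obtain g where g: "endpoints n W = g (code W)" for W by blast
  have im: "endpoints n ` ?W \<subseteq> g ` (code ` ?W)" using g by auto
  show "finite (endpoints n ` ?W)" by (rule finite_surj[OF fin im])
  have "card (endpoints n ` ?W) \<le> card (code ` ?W)" by (rule surj_card_le[OF fin im])
  also have "\<dots> \<le> card {B. B \<subseteq> \<Omega> \<and> card B \<le> ?m}"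
    using card_subsets_le(1)[OF card_\<Omega>(1)] sub by (rule card_mono)
  also have "\<dots> \<le> (card \<Omega> + 1) ^ ?m" by (rule card_subsets_le(2)[OF card_\<Omega>(1)])
  also have "\<dots> \<le> (x ^ 2 * (n + 1) ^ 2 + 1) ^ ?m"
  proof (intro power_mono add_right_mono)
    have "card \<Omega> \<le> (2 * K * R + 1) * (2 * R + 1) * (n + 1) ^ 2" by (rule card_\<Omega>)
    also have "\<dots> \<le> (x * x) * (n + 1) ^ 2"
      by (intro mult_right_mono mult_mono) (auto simp: x_def algebra_simps)
    finally show "card \<Omega> \<le> x ^ 2 * (n + 1) ^ 2" by (simp add: power2_eq_square)
  qed simp
  finally show "card (endpoints n ` ?W) \<le> (x ^ 2 * (n + 1) ^ 2 + 1) ^ ?m" .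
qed

end

section \<open>The growth estimate for line systems\<close>

text \<open>Let \<open>s = sqrt (ln n)\<close> and let \<open>k\<close> be its integer part. Then
  \<open>c ^ k\<close> is at most \<open>exp (s * b)\<close>, negligible against
  \<open>n = exp (s ^ 2)\<close>, and \<open>q ^ k\<close> gains \<open>exp (- s * \<delta>)\<close>
  up to a constant. Half of this gain absorbs the factor that is polynomial in
  \<open>s\<close>.\<close>

lemma growth_numeric:
  fixes d1 d c q :: real
  assumes "d1 \<ge> 0" "d \<ge> 1" "c \<ge> 1" "0 < q" "q < 1"
  obtains C1 C2 :: real where "C1 > 0" "C2 > 0"
    "\<And>n::nat. n \<ge> 1 \<Longrightarrow> \<exists>k. d1 * (c ^ k + q ^ k * real n) * (2 * (ln (2 * d) + real k * ln c + ln (real n + 1)))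
       \<le> C1 * real n * exp (- C2 * sqrt (ln (real n)))"
proof -
  define \<delta> where "\<delta> = - ln q"
  have \<delta>: "\<delta> > 0" using assms by (simp add: \<delta>_def)
  define b where "b = ln c + 1"
  define d2 where "d2 = ln (2 * d) + 1"
  have b: "b > 0" "ln c \<le> b" using assms by (auto simp: b_def add_nonneg_pos)
  have d2: "ln (2 * d) \<le> d2" "d2 \<ge> 0" using assms by (auto simp: d2_def)
  define g where "g = (\<lambda>s. d1 * (exp (s * b) + exp (\<delta> - s * \<delta>) * exp (s ^ 2)) * (2 * (d2 + s * b + (s ^ 2 + 1))))"
  \<comment> \<open>The quotient of the bound by the target. It tends to 0 and is continuous, so it
    is bounded above for all \<open>s \<ge> 0\<close>.\<close>
  define h where "h = (\<lambda>s. g s / exp (s ^ 2 - \<delta> / 2 * s))"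
  have "(h \<longlongrightarrow> 0) at_top"
    unfolding h_def g_def using \<delta> b by real_asymp
  then have "\<forall>\<^sub>F s in at_top. h s < 1" by (rule order_tendstoD) simp
  then obtain s0 where s0: "\<And>s. s \<ge> s0 \<Longrightarrow> h s < 1" by (auto simp: eventually_at_top_linorder)
  have "continuous_on {0..s0} h" unfolding h_def g_def by (intro continuous_intros) auto
  then have "bounded (h ` {0..s0})" by (intro compact_imp_bounded compact_continuous_image) auto
  then have "\<exists>M. \<forall>s\<in>{0..s0}. \<bar>h s\<bar> \<le> M" by (simp add: bounded_iff)
  then obtain M where M: "\<And>s. s \<in> {0..s0} \<Longrightarrow> \<bar>h s\<bar> \<le> M" by blast
  define C1 where "C1 = max 1 M"
  have hC: "h s \<le> C1" if "s \<ge> 0" for s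
    using s0[of s] M[of s] that by (cases "s \<le> s0") (auto simp: C1_def)
  show ?thesis
  proof (rule that[of C1 "\<delta> / 2"])
    show "C1 > 0" "\<delta> / 2 > 0" using \<delta> by (auto simp: C1_def)
    fix n :: nat assume n: "n \<ge> 1"
    define s where "s = sqrt (ln (real n))"
    define k where "k = nat \<lfloor>s\<rfloor>"
    have s: "s \<ge> 0" "s ^ 2 = ln (real n)" using n by (auto simp: s_def)
    have k: "real k \<le> s" "s - 1 \<le> real k" using s(1) unfolding k_def by linarith+
    have n': "real n = exp (s ^ 2)" using n s by simp
    have "c ^ k = exp (real k * ln c)" using assms by (simp add: exp_of_nat_mult)
    also have "\<dots> \<le> exp (s * b)" using k b s assms by (auto intro!: mult_mono)
    finally have 1: "c ^ k \<le> exp (s * b)" .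
    have "q ^ k = exp (real k * - \<delta>)" using assms by (simp add: exp_of_nat_mult \<delta>_def)
    also have "\<dots> \<le> exp (\<delta> - s * \<delta>)" using mult_right_mono[OF k(2), of \<delta>] \<delta> by (simp add: algebra_simps)
    finally have 2: "q ^ k \<le> exp (\<delta> - s * \<delta>)" .
    have "real n + 1 \<le> real n * 2" using n by simp
    also have "\<dots> \<le> real n * exp 1" using exp_ge_add_one_self[of 1] by (intro mult_left_mono) auto
    finally have "ln (real n + 1) \<le> ln (real n * exp 1)" using n by (subst ln_le_cancel_iff) auto
    also have "\<dots> = s ^ 2 + 1" using n s by (simp add: ln_mult)
    finally have 3: "ln (real n + 1) \<le> s ^ 2 + 1" .
    have 4: "real k * ln c \<le> s * b" using k b s assms by (intro mult_mono) auto
    have "d1 * (c ^ k + q ^ k * real n) * (2 * (ln (2 * d) + real k * ln c + ln (real n + 1))) \<le> g s"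
    proof -
      have "q ^ k * real n \<le> exp (\<delta> - s * \<delta>) * exp (s ^ 2)" using 2 n' by simp
      then have a: "d1 * (c ^ k + q ^ k * real n) \<le> d1 * (exp (s * b) + exp (\<delta> - s * \<delta>) * exp (s ^ 2))"
        using 1 assms by (intro mult_left_mono) auto
      have b': "2 * (ln (2 * d) + real k * ln c + ln (real n + 1)) \<le> 2 * (d2 + s * b + (s ^ 2 + 1))"
        using 3 4 d2 by simp
      have "0 \<le> 2 * (ln (2 * d) + real k * ln c + ln (real n + 1))" using assms by simp
      then show ?thesis unfolding g_def using assms by (intro mult_mono[OF a b']) auto
    qed
    also have "\<dots> = h s * exp (s ^ 2 - \<delta> / 2 * s)" by (simp add: h_def)
    also have "\<dots> \<le> C1 * exp (s ^ 2 - \<delta> / 2 * s)" using hC[OF s(1)] by (intro mult_right_mono) auto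
    also have "\<dots> = C1 * real n * exp (- (\<delta> / 2) * s)" by (simp add: n' flip: exp_add)
    finally show "\<exists>k. d1 * (c ^ k + q ^ k * real n) * (2 * (ln (2 * d) + real k * ln c + ln (real n + 1)))
       \<le> C1 * real n * exp (- (\<delta> / 2) * sqrt (ln (real n)))" unfolding s_def by blast
  qed
qed

context line_system begin

text \<open>Injecting the group elements into this set bounds their number only if the set is
  finite; radius 1 and the trivial bound \<open>n\<close> on crossings suffice.\<close>

lemma finite_endpoints: "finite (endpoints n ` {W. \<forall>u. W u \<in> S})"
proof -
  obtain D where D: "D \<in> Ps" using Ps_nonempty by blast
  interpret line_coding S Ls L Ps K D 1 n by unfold_locales (use D in auto)
  show ?thesis by (rule card_endpoints(1)[of n]) (rule card_traversal_starts_le)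
qed

lemma card_endpoints_bound:
  obtains d1 d :: real where "d1 \<ge> 0" "d \<ge> 1"
    "\<And>n k. real (card (endpoints n ` {W. \<forall>u. W u \<in> S})) \<le>
      exp (d1 * (real C ^ k + rate ^ k * real n) * (2 * (ln (2 * d) + real k * ln (real C) + ln (real n + 1))))"
proof -
  obtain D where D: "D \<in> Ps" using Ps_nonempty by blast
  \<comment> \<open>These constants involve neither \<open>n\<close> nor \<open>k\<close>. The
    choice of \<open>d\<close> gives \<open>x \<le> d * C ^ k\<close>, and \<open>d1\<close>
    collects the constant factors of the exponent.\<close>
  define c0 where "c0 = 2 * K * C + 2 * K + C + 6"
  define N where "N = 4 * (K * c0 + 1)"
  define d where "d = 4 * (K + 1) * c0 + 1"
  define d1 where "d1 = d + N * (d + 1)"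
  show ?thesis
  proof (rule that[of "real d1" "real d"])
    show "0 \<le> real d1" "1 \<le> real d" by (auto simp: d_def)
    fix n k :: nat
    have Ck: "C ^ k \<ge> 1" using C_pos by (intro one_le_power) linarith
    interpret lc: line_coding S Ls L Ps K D "C ^ k" n by unfold_locales (use D Ck in auto)
    define I where "I = nat \<lfloor>rate ^ k * real n\<rfloor>"
    define x where "x = 2 * (K + 1) * lc.R + 1"
    define m where "m = x + N * (x + 1 + I)"
    have I0: "rate ^ k * real n \<ge> 0" using rate by simp
    then have I: "real I \<le> rate ^ k * real n" unfolding I_def by linarith
    have "card (lc.inward W) \<le> I" if W: "\<And>u. W u \<in> S" for W
      using inward_decay[where W=W and n=n and k=k, OF W] unfolding I_def by (simp add: le_nat_floor)
    then have "card (endpoints n ` {W. \<forall>u. W u \<in> S}) \<le> (x ^ 2 * (n + 1) ^ 2 + 1) ^ m"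
      unfolding m_def N_def x_def c0_def using lc.card_endpoints(2)[of I] unfolding lc.c0_def by blast
    then have "real (card (endpoints n ` {W. \<forall>u. W u \<in> S})) \<le> real ((x ^ 2 * (n + 1) ^ 2 + 1) ^ m)"
      by (simp only: of_nat_le_iff)
    also have "\<dots> = exp (real m * ln (real (x ^ 2 * (n + 1) ^ 2 + 1)))"
      by (simp add: exp_of_nat_mult del: of_nat_mult of_nat_power of_nat_Suc)
    also have "\<dots> \<le> exp (real d1 * (real C ^ k + rate ^ k * real n) * (2 * (ln (2 * real d) + real k * ln (real C) + ln (real n + 1))))"
    proof -
      have "lc.R \<le> c0 * (C ^ k + 1)" using lc.R_le by (simp add: c0_def lc.c0_def)
      also have "\<dots> \<le> c0 * (2 * C ^ k)" using Ck by (intro mult_left_mono) auto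
      finally have "2 * (K + 1) * lc.R \<le> 2 * (K + 1) * (c0 * (2 * C ^ k))" by (rule mult_left_mono) simp
      then have x: "x \<le> d * C ^ k" using Ck by (simp add: x_def d_def algebra_simps)
      have x1: "x \<ge> 1" by (simp add: x_def)
      have a: "real m \<le> real d1 * (real C ^ k + rate ^ k * real n)"
      proof -
        have xr: "real x \<le> real d * real C ^ k" using x by (simp flip: of_nat_power of_nat_mult)
        have "real m = real x + real N * (real x + 1 + real I)" by (simp add: m_def algebra_simps)
        also have "\<dots> \<le> real d * real C ^ k + real N * (real d * real C ^ k + real C ^ k + rate ^ k * real n)"
          using xr I Ck by (intro add_mono mult_left_mono) (auto simp flip: of_nat_power)
        also have "\<dots> = real d1 * real C ^ k + real N * (rate ^ k * real n)"
          by (simp add: d1_def algebra_simps)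
        also have "\<dots> \<le> real d1 * real C ^ k + real d1 * (rate ^ k * real n)"
          using I0 by (intro add_left_mono mult_right_mono) (auto simp: d1_def)
        finally show ?thesis by (simp add: algebra_simps)
      qed
      have "x ^ 2 * (n + 1) ^ 2 + 1 \<le> (2 * (x * (n + 1))) ^ 2"
      proof -
        have "1 \<le> (x * (n + 1)) ^ 2" using x1 by simp
        then have "(x * (n + 1)) ^ 2 + 1 \<le> 4 * (x * (n + 1)) ^ 2" by linarith
        then show ?thesis by (simp only: power_mult_distrib) simp
      qed
      also have "\<dots> \<le> (2 * (d * C ^ k * (n + 1))) ^ 2"
        using x by (intro power_mono mult_left_mono mult_right_mono) auto
      finally have "real (x ^ 2 * (n + 1) ^ 2 + 1) \<le> real ((2 * (d * C ^ k * (n + 1))) ^ 2)"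
        by (simp only: of_nat_le_iff)
      also have "\<dots> = ((2 * real d) * real C ^ k * (real n + 1)) ^ 2" by (simp add: algebra_simps)
      finally have "ln (real (x ^ 2 * (n + 1) ^ 2 + 1)) \<le> ln (((2 * real d) * real C ^ k * (real n + 1)) ^ 2)"
        by (rule ln_mono) (simp only: of_nat_0_less_iff add_gr_0 zero_less_one simp_thms)
      also have "\<dots> = 2 * ln ((2 * real d) * real C ^ k * (real n + 1))"
        by (subst ln_realpow) (use C_pos in \<open>auto simp: d_def intro!: mult_pos_pos add_pos_nonneg\<close>)
      also have "ln ((2 * real d) * real C ^ k * (real n + 1)) = ln (2 * real d) + real k * ln (real C) + ln (real n + 1)"
      proof -
        have "d > 0" by (simp add: d_def)
        then have "real C ^ k > 0" "2 * real d > 0" "real n + 1 > 0" "real C > 0" using C_pos by auto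
        then show ?thesis by (simp add: ln_mult ln_realpow)
      qed
      finally have b: "ln (real (x ^ 2 * (n + 1) ^ 2 + 1)) \<le> 2 * (ln (2 * real d) + real k * ln (real C) + ln (real n + 1))" .
      have "0 \<le> real d1 * (real C ^ k + rate ^ k * real n)" using I0 by simp
      then show ?thesis using a b by (intro iffD2[OF exp_le_cancel_iff] mult_mono) auto
    qed
    finally show "real (card (endpoints n ` {W. \<forall>u. W u \<in> S})) \<le>
      exp (real d1 * (real C ^ k + rate ^ k * real n) * (2 * (ln (2 * real d) + real k * ln (real C) + ln (real n + 1))))" .
  qed
qed

theorem endpoints_growth:
  obtains C1 C2 :: real where "C1 > 0" "C2 > 0"
    "\<And>n. n \<ge> 1 \<Longrightarrow> real (card (endpoints n ` {W. \<forall>u. W u \<in> S})) \<le> exp (C1 * real n * exp (- C2 * sqrt (ln (real n))))"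
proof -
  obtain d1 d :: real where d: "d1 \<ge> 0" "d \<ge> 1"
    "\<And>n k. real (card (endpoints n ` {W. \<forall>u. W u \<in> S})) \<le>
      exp (d1 * (real C ^ k + rate ^ k * real n) * (2 * (ln (2 * d) + real k * ln (real C) + ln (real n + 1))))"
    using card_endpoints_bound by blast
  have "real C \<ge> 1" using C_pos by simp
  from growth_numeric[OF d(1,2) this rate] obtain C1 C2 :: real where C: "C1 > 0" "C2 > 0"
    "\<And>n::nat. n \<ge> 1 \<Longrightarrow> \<exists>k. d1 * (real C ^ k + rate ^ k * real n) * (2 * (ln (2 * d) + real k * ln (real C) + ln (real n + 1)))
       \<le> C1 * real n * exp (- C2 * sqrt (ln (real n)))" by blast
  have "real (card (endpoints n ` {W. \<forall>u. W u \<in> S})) \<le> exp (C1 * real n * exp (- C2 * sqrt (ln (real n))))" if "n \<ge> 1" for n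
    using C(3)[OF that] d(3)[of n] by (meson exp_le_cancel_iff order_trans)
  then show ?thesis using that C by blast
qed

end

section \<open>Orbits of the dihedral group\<close>

primrec alternating :: "('a \<Rightarrow> 'a) \<Rightarrow> ('a \<Rightarrow> 'a) \<Rightarrow> nat \<Rightarrow> 'a \<Rightarrow> 'a" where
  "alternating a b 0 x = x"
| "alternating a b (Suc n) x = (if even n then a else b) (alternating a b n x)"

locale involutions =
  fixes a b :: "'a \<Rightarrow> 'a"
  assumes inv_a: "a (a x) = x" and inv_b: "b (b x) = x"
begin

text \<open>The orbit as a line: \<open>a\<close> exchanges the ends of each even edge and
  \<open>b\<close> those of each odd edge.\<close>

definition pos :: "'a \<Rightarrow> int \<Rightarrow> 'a" where
  "pos x i = (if i \<ge> 0 then alternating a b (nat i) x else alternating b a (nat (- i)) x)"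

definition letter :: "int \<Rightarrow> 'a \<Rightarrow> 'a" where
  "letter i = (if even i then a else b)"

lemma pos_0 [simp]: "pos x 0 = x"
  by (simp add: pos_def)

lemma letter_invol [simp]: "letter i (letter i x) = x"
  by (simp add: letter_def inv_a inv_b)

lemma letter_parity: "even (i - j) \<Longrightarrow> letter i = letter j"
  by (auto simp: letter_def)

lemma letter_pos: "letter i (pos x i) = pos x (i + 1)"
proof (cases "i \<ge> 0")
  case True
  then have "nat (i + 1) = Suc (nat i)" by simp
  then show ?thesis using True by (simp add: pos_def letter_def even_nat_iff)
next
  case False
  define m where "m = nat (- (i + 1))"
  have i: "i = - int (Suc m)" using False by (simp add: m_def)
  have "pos x i = letter i (alternating b a m x)" by (simp add: pos_def i letter_def nat_add_distrib)
  moreover have "pos x (i + 1) = alternating b a m x" by (cases m) (auto simp: pos_def i nat_add_distrib)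
  ultimately show ?thesis by simp
qed

lemma letter_pos': "letter i (pos x (i + 1)) = pos x i"
  by (simp flip: letter_pos)

text \<open>At an odd position \<open>a\<close> leads to the left; this is the source of the
  reversal in \<open>chart\<close> and \<open>recenter\<close>.\<close>

lemma pos_pos: "pos (pos x c) j = pos x (chart c j)"
proof (induction j rule: int_induct[where k=0])
  case (step1 j)
  show ?case
  proof (cases "even c")
    case True
    then have "letter j = letter (c + j)" by (intro letter_parity) simp
    then show ?thesis using step1 letter_pos[of j "pos x c"] letter_pos[of "c + j" x] True 
      by (simp add: chart_def add.assoc)
  next
    case False
    then have "letter j = letter (c - (j + 1))" by (intro letter_parity) simp
    then show ?thesis using step1 letter_pos[of j "pos x c"] letter_pos'[of "c - (j + 1)" x] False
      by (simp add: chart_def)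
  qed
next
  case (step2 j)
  show ?case
  proof (cases "even c")
    case True
    then have "letter (j - 1) = letter (c + (j - 1))" by (intro letter_parity) simp
    then show ?thesis using step2 letter_pos'[of "j - 1" "pos x c"] letter_pos'[of "c + (j - 1)" x] True 
      by (simp add: chart_def add.assoc)
  next
    case False
    then have "letter (j - 1) = letter (c - j)" by (intro letter_parity) simp
    then show ?thesis using step2 letter_pos'[of "j - 1" "pos x c"] letter_pos[of "c - j" x] False
      by (simp add: chart_def algebra_simps)
  qed
qed (simp add: chart_def)

definition free :: "'a \<Rightarrow> bool" where "free x \<longleftrightarrow> inj (pos x)"

lemma free_pos: "free x \<Longrightarrow> free (pos x c)"
  unfolding free_def inj_def pos_pos
proof (intro allI impI)
  fix i j assume "\<forall>i j. pos x i = pos x j \<longrightarrow> i = j" "pos x (chart c i) = pos x (chart c j)"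
  then have "chart c i = chart c j" by blast
  then show "i = j" by (simp add: chart_def split: if_splits)
qed

lemma free_neq: "free x \<Longrightarrow> i \<noteq> j \<Longrightarrow> pos x i \<noteq> pos x j"
  by (auto simp: free_def inj_def)

lemma fold_reflect:
  assumes "pos x i = pos x (i + 1)"
  shows "pos x (2 * i + 1 - j) = pos x j"
proof -
  have n: "pos x (i - int k) = pos x (i + 1 + int k)" for k
  proof (induction k)
    case (Suc k)
    have "letter (i - int k - 1) = letter (i + 1 + int k)" by (rule letter_parity) simp
    then show ?case using Suc letter_pos'[of "i - int k - 1" x] letter_pos[of "i + 1 + int k" x]
      by (simp add: algebra_simps)
  qed (use assms in simp)
  show ?thesis
  proof (cases "j \<le> i")
    case True
    then show ?thesis using n[of "nat (i - j)"] by (simp add: algebra_simps)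
  next
    case False
    then show ?thesis using n[of "nat (j - i - 1)"] by (simp add: algebra_simps)
  qed
qed

lemma period_finite:
  assumes eq: "pos x i = pos x (i + p)" and p: "even p" "p \<noteq> 0"
  shows "finite (range (pos x))"
proof -
  have per: "pos x (k + p) = pos x k" for k
  proof (induction k rule: int_induct[where k=i])
    case (step1 k)
    have "letter (k + p) = letter k" by (rule letter_parity) (simp add: p)
    then show ?case using step1 letter_pos[of "k + p" x] letter_pos[of k x] by (simp add: algebra_simps)
  next
    case (step2 k)
    have "letter (k - 1 + p) = letter (k - 1)" by (rule letter_parity) (simp add: p)
    then show ?case using step2 letter_pos'[of "k - 1 + p" x] letter_pos'[of "k - 1" x] by (simp add: algebra_simps)
  qed (simp add: eq)
  have perm: "pos x (k + m * p) = pos x k" for k m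
  proof (induction m rule: int_induct[where k=0])
    case (step1 m)
    then show ?case using per[of "k + m * p"] by (simp add: algebra_simps)
  next
    case (step2 m)
    then show ?case using per[of "k + (m - 1) * p"] by (simp add: algebra_simps)
  qed simp
  define P where "P = \<bar>p\<bar>"
  have "pos x k \<in> pos x ` {0..<P}" for k
  proof -
    have "k mod P + (k div P * sgn p) * p = k"
      by (simp add: P_def mult.assoc sgn_mult_self_eq abs_sgn flip: abs_sgn) (metis abs_sgn div_mult_mod_eq add.commute mult.assoc mult.commute)
    then have "pos x k = pos x (k mod P)" using perm[of "k mod P" "k div P * sgn p"] by simp
    then show ?thesis using p by (simp add: P_def)
  qed
  then have "range (pos x) \<subseteq> pos x ` {0..<P}" by blast
  then show ?thesis by (rule finite_subset) simp
qed

text \<open>Reflections in two different edges compose to an even translation.\<close>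

lemma two_folds_finite:
  assumes "pos x i = pos x (i + 1)" "pos x i' = pos x (i' + 1)" "i \<noteq> i'"
  shows "finite (range (pos x))"
proof (rule period_finite[of x 0 "2 * (i' - i)"])
  show "pos x 0 = pos x (0 + 2 * (i' - i))"
    using fold_reflect[OF assms(1), of 0] fold_reflect[OF assms(2), of "2 * i + 1"] by (simp add: algebra_simps)
qed (use assms in auto)

text \<open>Equal positions at even distance would give a period. At odd distance the letters
  between them read the same from both ends, so the equality moves inwards to the middle
  edge.\<close>

lemma not_free_fold:
  assumes inf: "infinite (range (pos x))" and "\<not> free x"
  obtains i where "pos x i = pos x (i + 1)"
proof -
  obtain i j where ij: "i < j" "pos x i = pos x j"
    using assms(2) unfolding free_def inj_def by (metis linorder_neqE)
  have odd: "odd (j - i)"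
  proof
    assume "even (j - i)"
    then have "finite (range (pos x))" using period_finite[of x i "j - i"] ij by simp
    then show False using inf by simp
  qed
  then obtain m where m: "j = i + (2 * m + 1)" by (metis oddE add.commute diff_add_cancel)
  have "m \<ge> 0" using ij m by simp
  have "int k \<le> m \<Longrightarrow> pos x (i + int k) = pos x (j - int k)" for k
  proof (induction k)
    case (Suc k)
    have "letter (i + int k) = letter (j - int k - 1)" by (rule letter_parity) (simp add: m)
    then show ?case using Suc letter_pos[of "i + int k" x] letter_pos'[of "j - int k - 1" x]
      by (simp add: algebra_simps)
  qed (simp add: ij)
  from this[of "nat m"] have "pos x (i + m) = pos x (i + m + 1)" using \<open>m \<ge> 0\<close> by (simp add: m algebra_simps)
  then show ?thesis by (rule that)
qed

lemma pos_induct: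
  assumes "P x" "\<And>y. P y \<Longrightarrow> P (a y)" "\<And>y. P y \<Longrightarrow> P (b y)"
  shows "P (pos x i)"
proof (induction i rule: int_induct[where k=0])
  case (step1 i)
  then show ?case using assms by (simp add: letter_def flip: letter_pos)
next
  case (step2 i)
  have "pos x (i - 1) = letter (i - 1) (pos x i)" using letter_pos'[of "i - 1" x] by simp
  then show ?case using step2 assms by (simp add: letter_def)
qed (simp add: assms)

end

section \<open>Cantor sets\<close>

lemma cantor_Hausdorff:
  assumes "is_cantor_set TYPE('a::topological_space)"
  shows "Hausdorff_space (euclidean :: 'a topology)" "compact_space (euclidean :: 'a topology)"
proof -
  let ?P = "product_topology (\<lambda>_::nat. discrete_topology (UNIV :: bool set)) UNIV"
  have h: "(euclidean :: 'a topology) homeomorphic_space ?P" using assms by (simp add: is_cantor_set_def)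
  have "Hausdorff_space ?P" by (simp add: Hausdorff_space_product_topology Hausdorff_space_discrete_topology)
  then show "Hausdorff_space (euclidean :: 'a topology)" using homeomorphic_Hausdorff_space[OF h] by simp
  have "compact_space ?P" by (simp add: compact_space_product_topology compact_space_discrete_topology)
  then show "compact_space (euclidean :: 'a topology)" using homeomorphic_compact_space[OF h] by simp
qed

lemma cantor_separate:
  assumes "is_cantor_set TYPE('a::topological_space)" "(x::'a) \<noteq> y"
  obtains U V where "open U" "open V" "x \<in> U" "y \<in> V" "U \<inter> V = {}"
proof -
  have "\<exists>U V. open U \<and> open V \<and> x \<in> U \<and> y \<in> V \<and> U \<inter> V = {}"
    using cantor_Hausdorff(1)[OF assms(1)] assms(2) unfolding Hausdorff_space_def disjnt_def by simp
  then show ?thesis using that by blast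
qed

lemma cantor_open_neq:
  assumes "is_cantor_set TYPE('a::topological_space)" 
    and f: "continuous_on UNIV f" and g: "continuous_on UNIV (g :: 'a \<Rightarrow> 'a)"
  shows "open {x. f x \<noteq> g x}"
proof (subst open_subopen, rule ballI)
  fix x assume "x \<in> {x. f x \<noteq> g x}"
  then have "f x \<noteq> g x" by simp
  then obtain U V where UV: "open U" "open V" "f x \<in> U" "g x \<in> V" "U \<inter> V = {}"
    by (rule cantor_separate[OF assms(1)])
  have "open (f -` U \<inter> g -` V)" using f g UV by (intro open_Int open_vimage)
  then show "\<exists>T. open T \<and> x \<in> T \<and> T \<subseteq> {x. f x \<noteq> g x}"
    using UV by (intro exI[of _ "f -` U \<inter> g -` V"]) auto
qed

lemma cantor_not_isolated:
  assumes "is_cantor_set TYPE('a::topological_space)"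
  shows "\<not> open {x :: 'a}"
proof
  assume o: "open {x}"
  let ?P = "product_topology (\<lambda>_::nat. discrete_topology (UNIV :: bool set)) UNIV"
  obtain f where f: "homeomorphic_map (euclidean :: 'a topology) ?P f"
    using assms unfolding is_cantor_set_def homeomorphic_space by blast
  have "openin ?P (f ` {x})" using homeomorphic_map_openness_eq[OF f] o by simp
  then obtain U where U: "finite {i. U i \<noteq> UNIV}" "f x \<in> Pi\<^sub>E UNIV U" "Pi\<^sub>E UNIV U \<subseteq> {f x}"
    unfolding openin_product_topology_alt by auto
  \<comment> \<open>A coordinate that the basic neighbourhood leaves free; flipping it gives a
    second point.\<close>
  obtain i where i: "i \<notin> {i. U i \<noteq> UNIV}" using U(1) by (metis ex_new_if_finite infinite_UNIV_nat)
  have "(f x)(i := \<not> f x i) \<in> Pi\<^sub>E UNIV U" using U(2) i by (auto simp: PiE_def Pi_def)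
  then have "(f x)(i := \<not> f x i) = f x" using U(3) by auto
  then show False by (metis fun_upd_same)
qed

lemma cantor_closed_finite:
  assumes "is_cantor_set TYPE('a::topological_space)" "finite (F :: 'a set)"
  shows "closed F"
proof -
  have "closedin (euclidean :: 'a topology) F"
    using cantor_Hausdorff(1)[OF assms(1)] assms(2)
    by (intro closedin_Hausdorff_finite) auto
  then show ?thesis by simp
qed

lemma cantor_Baire:
  assumes "is_cantor_set TYPE('a::topological_space)" "countable \<G>"
    and "\<And>T. T \<in> \<G> \<Longrightarrow> closed T \<and> interior T = {}"
  shows "interior (\<Union>\<G> :: 'a set) = {}"
proof -
  have "(euclidean :: 'a topology) interior_of \<Union>\<G> = {}"
  proof (rule Baire_category_alt)
    show "completely_metrizable_space (euclidean :: 'a topology) \<or>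
      locally_compact_space (euclidean :: 'a topology) \<and> regular_space (euclidean :: 'a topology)"
      using cantor_Hausdorff[OF assms(1)] compact_imp_locally_compact_space compact_Hausdorff_imp_regular_space by blast
  qed (use assms in \<open>auto\<close>)
  then show ?thesis by simp
qed

section \<open>Orbital graphs of a fragmentation\<close>

lemma homeo_groupD:
  assumes "h \<in> carrier homeo_group"
  shows "continuous_on UNIV h" "inj h"
proof -
  obtain h' where "homeomorphism UNIV UNIV h h'" using assms by (auto simp: homeo_group_def)
  then show "continuous_on UNIV h" "inj h"
    by (auto simp: homeomorphism_def) (metis injI UNIV_I)
qed

lemma homeo_group_simps [simp]:
  "f \<otimes>\<^bsub>homeo_group\<^esub> g = f \<circ> g" "\<one>\<^bsub>homeo_group\<^esub> = id"
  by (auto simp: homeo_group_def)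

lemma homeo_inv_involution:
  assumes "h \<in> carrier homeo_group" "\<And>x. h (h x) = x"
  shows "inv\<^bsub>homeo_group\<^esub> h = h"
  using group.inv_equality[OF group_homeo_group _ assms(1) assms(1)] assms(2) by (simp add: fun_eq_iff)

locale dihedral_fragmentation =
  fixes a b :: "'a::topological_space \<Rightarrow> 'a" and A B :: "('a \<Rightarrow> 'a) set"
  assumes cantor: "is_cantor_set TYPE('a)"
    and per_a: "period_two a" and per_b: "period_two b"
    and minimal: "minimal_action (generate homeo_group {a, b})"
    and frag_a: "fragmentation a A" and frag_b: "fragmentation b B"
begin

sublocale involutions a b
proof
  show "a (a x) = x" "b (b x) = x" for x
    using per_a per_b unfolding period_two_def by (metis comp_apply id_apply)+
qed

definition frag :: "int \<Rightarrow> ('a \<Rightarrow> 'a) set" where "frag i = (if even i then A else B)"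

definition S :: "('a \<Rightarrow> 'a) set" where "S = A \<union> B"

definition G :: "('a \<Rightarrow> 'a) set" where "G = generate homeo_group S"

lemma frag_cases: "frag i \<subseteq> S" and S_frag: "s \<in> S \<Longrightarrow> \<exists>i. s \<in> frag i"
proof -
  show "frag i \<subseteq> S" by (auto simp: frag_def S_def)
  assume "s \<in> S"
  then have "s \<in> frag 0 \<or> s \<in> frag 1" by (auto simp: frag_def S_def)
  then show "\<exists>i. s \<in> frag i" by blast
qed

lemma frag_fragmentation: "fragmentation (letter i) (frag i)"
  using frag_a frag_b by (simp add: letter_def frag_def)

lemma frag_parity: "even (i - j) \<Longrightarrow> frag i = frag j"
  by (auto simp: frag_def)

lemma frag_subgroup: "subgroup (frag i) homeo_group"
  and frag_moves: "s \<in> frag i \<Longrightarrow> s x = x \<or> s x = letter i x"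
  and frag_ex: "\<exists>s\<in>frag i. s x = letter i x"
  and finite_frag: "finite (frag i)"
  using frag_fragmentation[of i] by (auto simp: fragmentation_def)

lemma frag_carrier: "s \<in> frag i \<Longrightarrow> s \<in> carrier homeo_group"
  using subgroup.mem_carrier[OF frag_subgroup] .

lemma frag_comp: "s \<in> frag i \<Longrightarrow> s' \<in> frag i \<Longrightarrow> s \<circ> s' \<in> frag i"
  using subgroup.m_closed[OF frag_subgroup, of s i s'] by simp

lemma frag_id: "id \<in> frag i"
  using subgroup.one_closed[OF frag_subgroup, of i] by simp

lemma S_carrier: "s \<in> S \<Longrightarrow> s \<in> carrier homeo_group"
  using S_frag frag_carrier by blast

text \<open>Otherwise \<open>s\<close> would map \<open>p\<close> and its partner to the same point.
  Hence every generator is an involution.\<close>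

lemma frag_swap:
  assumes s: "s \<in> frag i" and "s p = letter i p"
  shows "s (letter i p) = p"
proof (rule ccontr)
  assume n: "s (letter i p) \<noteq> p"
  then have "s (letter i p) = letter i p" using frag_moves[OF s, of "letter i p"] by simp
  then have "s (letter i p) = s p" using assms by simp
  then have "letter i p = p" using homeo_groupD(2)[OF frag_carrier[OF s]] by (auto dest: injD)
  then show False using n assms by simp
qed

lemma S_invol:
  assumes "s \<in> S" shows "s (s x) = x"
proof -
  obtain i where i: "s \<in> frag i" using S_frag assms by blast
  show ?thesis using frag_moves[OF i, of x] frag_swap[OF i, of x] by auto
qed

lemma S_inv: "s \<in> S \<Longrightarrow> inv\<^bsub>homeo_group\<^esub> s = s"
  using homeo_inv_involution S_carrier S_invol by blast

lemma continuous_letter: "continuous_on UNIV (letter i)"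
  using per_a per_b homeo_groupD unfolding period_two_def letter_def by auto

lemma continuous_S: "s \<in> S \<Longrightarrow> continuous_on UNIV s"
  using S_carrier homeo_groupD by blast

lemma continuous_pos: "continuous_on UNIV (\<lambda>x. pos x i)"
proof (induction i rule: int_induct[where k=0])
  case (step1 i)
  have "continuous_on UNIV (\<lambda>x. letter i (pos x i))"
    using continuous_on_compose2[OF continuous_letter step1(2)] by blast
  then show ?case by (simp only: letter_pos)
next
  case (step2 i)
  have "continuous_on UNIV (\<lambda>x. letter (i - 1) (pos x i))"
    using continuous_on_compose2[OF continuous_letter step2(2)] by blast
  moreover have "letter (i - 1) (pos x i) = pos x (i - 1)" for x using letter_pos'[of "i - 1" x] by simp
  ultimately show ?case by simp
qed simp

lemma letter_eq_pos:
  obtains e where "e \<noteq> 0" "\<And>x. letter i x = pos x e"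
proof (cases "even i")
  case True
  then have "letter i x = pos x 1" for x using letter_pos[of 0 x] by (simp add: letter_def)
  then show ?thesis using that[of 1] by simp
next
  case False
  then have "letter i x = pos x (- 1)" for x using letter_pos'[of "- 1" x] by (simp add: letter_def)
  then show ?thesis using that[of "- 1"] by simp
qed

lemma dihedral_orbit:
  assumes "g \<in> generate homeo_group {a, b}"
  shows "\<exists>i. \<forall>x. g x = pos x i"
proof -
  have "\<exists>i. \<forall>x. letter k x = pos x i" for k by (metis letter_eq_pos)
  from this[of 0] this[of 1] have ab: "\<exists>i. \<forall>x. h x = pos x i" if "h \<in> {a, b}" for h
    using that by (auto simp: letter_def)
  have "inv\<^bsub>homeo_group\<^esub> a = a" "inv\<^bsub>homeo_group\<^esub> b = b"
    using homeo_inv_involution per_a per_b inv_a inv_b unfolding period_two_def by blast+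
  then have inv: "inv\<^bsub>homeo_group\<^esub> h = h" if "h \<in> {a, b}" for h using that by auto
  show ?thesis
    using assms
  proof (induction rule: generate.induct)
    case one
    show ?case by (intro exI[of _ 0]) simp
  next
    case (eng h1 h2)
    then obtain i j where "\<forall>x. h1 x = pos x i" "\<forall>x. h2 x = pos x j" by blast
    then have "\<forall>x. (h1 \<circ> h2) x = pos x (chart j i)" by (simp add: pos_pos)
    then show ?case by (intro exI[of _ "chart j i"]) simp
  qed (use ab inv in auto)
qed

lemma orbit_dense: "closure (range (pos x)) = UNIV"
proof -
  have "orbit_of (generate homeo_group {a, b}) x \<subseteq> range (pos x)"
    using dihedral_orbit unfolding orbit_of_def by fastforce
  then have "closure (orbit_of (generate homeo_group {a, b}) x) \<subseteq> closure (range (pos x))"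
    by (rule closure_mono)
  then show ?thesis using minimal unfolding minimal_action_def by auto
qed

lemma orbit_infinite: "infinite (range (pos x))"
proof
  assume fin: "finite (range (pos x))"
  then have "closed (range (pos x))" by (rule cantor_closed_finite[OF cantor])
  then have U: "range (pos x) = UNIV" using orbit_dense[of x] by (simp add: closure_closed)
  then have "finite (- {x})" using fin by (metis finite_subset subset_UNIV)
  then have "closed (- {x})" by (rule cantor_closed_finite[OF cantor])
  then show False using cantor_not_isolated[OF cantor, of x] by (simp add: closed_def)
qed

lemma orbit_meets:
  assumes "open V" "V \<noteq> {}"
  obtains i where "pos x i \<in> V"
proof -
  have "range (pos x) \<inter> V \<noteq> {}"
    using open_Int_closure_eq_empty[OF assms(1), of "range (pos x)"] orbit_dense[of x] assms(2) by auto
  then show ?thesis using that by blast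
qed

lemma fold_unique: "pos x i = pos x (i + 1) \<Longrightarrow> pos x j = pos x (j + 1) \<Longrightarrow> i = j"
  using two_folds_finite orbit_infinite by blast

lemma pos_fold_eq:
  assumes f: "pos x i = pos x (i + 1)" and "pos x j = pos x k"
  shows "j = k \<or> j + k = 2 * i + 1"
proof -
  have np: "u = v" if "pos x u = pos x v" "even (v - u)" for u v
    using period_finite[of x u "v - u"] that orbit_infinite by (cases "u = v") auto
  show ?thesis
  proof (cases "even (k - j)")
    case True
    then show ?thesis using np assms by blast
  next
    case False
    then have "even (k - (2 * i + 1 - j))" by presburger
    moreover have "pos x (2 * i + 1 - j) = pos x k" using fold_reflect[OF f, of j] assms(2) by simp
    ultimately show ?thesis using np by force
  qed
qed

text \<open>If the interior contained \<open>x\<close>, then by minimality it would contain a point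
  \<open>pos x m\<close> other than \<open>x\<close>. Its fold is also a fold of the line of
  \<open>x\<close>, and folds are unique; so \<open>m\<close> is 0 or the mirror image of 0, and in
  both cases the point is \<open>x\<close>.\<close>

lemma fold_interior: "interior {x. pos x i = pos x (i + 1)} = {}"
proof (rule ccontr)
  let ?F = "{x. pos x i = pos x (i + 1)}"
  assume "interior ?F \<noteq> {}"
  then obtain x where x: "x \<in> interior ?F" by blast
  define V where "V = interior ?F - {x}"
  have "closed {x}" by (rule cantor_closed_finite[OF cantor]) simp
  then have o: "open V" unfolding V_def by (intro open_Diff) auto
  have "V \<noteq> {}"
  proof
    assume "V = {}"
    then have "interior ?F = {x}" using x by (auto simp: V_def)
    then show False using cantor_not_isolated[OF cantor, of x] open_interior[of ?F] by simp
  qed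
  then obtain m where m: "pos x m \<in> V" using orbit_meets[OF o] by blast
  have f: "pos x i = pos x (i + 1)" using x interior_subset by blast
  have "pos (pos x m) i = pos (pos x m) (i + 1)" using m interior_subset unfolding V_def by blast
  then have "chart m i = chart m (i + 1) \<or> chart m i + chart m (i + 1) = 2 * i + 1"
    unfolding pos_pos by (rule pos_fold_eq[OF f])
  then have "m = 0 \<or> m = 2 * i + 1" by (auto simp: chart_def split: if_splits)
  then have "pos x m = x" using fold_reflect[OF f, of 0] by auto
  then show False using m by (simp add: V_def)
qed

text \<open>A point is free unless its line has a fold, and the points with a fold at a given edge
  form a closed set without interior; Baire's theorem applies.\<close>

lemma free_dense:
  assumes "open V" "V \<noteq> {}"
  obtains x where "x \<in> V" "free x"
proof -
  let ?F = "\<lambda>i. {x. pos x i = pos x (i + 1)}"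
  have "interior (\<Union>(range ?F)) = {}"
  proof (rule cantor_Baire[OF cantor])
    fix T assume "T \<in> range ?F"
    then obtain i where T: "T = ?F i" by blast
    have "open {x. pos x i \<noteq> pos x (i + 1)}"
      by (intro cantor_open_neq[OF cantor] continuous_pos)
    moreover have "- T = {x. pos x i \<noteq> pos x (i + 1)}" using T by auto
    ultimately show "closed T \<and> interior T = {}" using fold_interior[of i] T by (simp add: closed_def)
  qed simp
  then have "\<not> V \<subseteq> \<Union>(range ?F)" using assms interior_maximal by blast
  then obtain x where x: "x \<in> V" "\<And>i. pos x i \<noteq> pos x (i + 1)" by auto
  have "free x"
  proof (rule ccontr)
    assume "\<not> free x"
    then obtain i where "pos x i = pos x (i + 1)" by (rule not_free_fold[OF orbit_infinite])
    then show False using x by blast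
  qed
  then show ?thesis using that x by blast
qed

section \<open>Labels of lines and germs of group elements\<close>

definition labels :: "'a \<Rightarrow> int \<Rightarrow> ('a \<Rightarrow> 'a) set" where
  "labels x i = {s \<in> frag i. s (pos x i) = pos x (i + 1)}"

lemma labels_back: "s \<in> labels x i \<Longrightarrow> s (pos x (i + 1)) = pos x i"
  using frag_swap[of s i "pos x i"] by (auto simp: labels_def letter_pos)

lemma labels_backI: "s \<in> frag i \<Longrightarrow> s (pos x (i + 1)) = pos x i \<Longrightarrow> s \<in> labels x i"
  using frag_swap[of s i "pos x (i + 1)"] by (auto simp: labels_def letter_pos letter_pos')

lemma labels_nonempty: "labels x i \<noteq> {}"
  using frag_ex[of i "pos x i"] by (auto simp: labels_def letter_pos)

lemma labels_pos: "labels (pos x c) = recenter (labels x) c"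
proof
  fix j
  show "labels (pos x c) j = recenter (labels x) c j"
  proof (cases "even c")
    case True
    then have "frag j = frag (c + j)" by (intro frag_parity) simp
    then show ?thesis using True by (simp add: labels_def recenter_def pos_pos chart_def add.assoc)
  next
    case False
    then have f: "frag j = frag (c - j - 1)" by (intro frag_parity) simp
    have "labels (pos x c) j = {s \<in> frag (c - j - 1). s (pos x (c - j - 1 + 1)) = pos x (c - j - 1)}"
      using False f by (simp add: labels_def pos_pos chart_def algebra_simps)
    also have "\<dots> = labels x (c - j - 1)"
      using labels_back[of _ x "c - j - 1"] labels_backI[of _ "c - j - 1" x] by (auto simp: labels_def)
    finally show ?thesis using False by (simp add: recenter_def)
  qed
qed

lemma disj_labels: assumes "free x" shows "disj_line (labels x)"
  unfolding disj_line_def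
proof (intro allI equals0I)
  fix i s assume s: "s \<in> labels x i \<inter> labels x (i + 1)"
  have "s (pos x (i + 1)) = pos x i" using s labels_back by blast
  moreover have "s (pos x (i + 1)) = pos x (i + 1 + 1)" using s by (auto simp: labels_def)
  ultimately show False using free_neq[OF assms, of i "i + 1 + 1"] by simp
qed

lemma S_step:
  assumes s: "s \<in> S" shows "s (pos x i) = pos x (step s (labels x) i)"
proof -
  consider (1) "s \<in> labels x i" | (2) "s \<notin> labels x i" "s \<in> labels x (i - 1)"
    | (3) "s \<notin> labels x i" "s \<notin> labels x (i - 1)" by blast
  then show ?thesis
  proof cases
    case 2
    then show ?thesis using labels_back[of s x "i - 1"] by (simp add: step_def)
  next
    case 3
    have "s \<in> frag i \<or> s \<in> frag (i - 1)" using s by (auto simp: S_def frag_def)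
    then have "s (pos x i) = pos x i"
    proof
      assume f: "s \<in> frag i"
      then show ?thesis using frag_moves[OF f, of "pos x i"] 3 by (auto simp: labels_def letter_pos)
    next
      assume f: "s \<in> frag (i - 1)"
      then show ?thesis using frag_moves[OF f, of "pos x i"] 3(2) labels_backI[OF f, of x] letter_pos'[of "i - 1" x] by auto
    qed
    then show ?thesis using 3 by (simp add: step_def)
  qed (simp add: labels_def step_def)
qed

lemma G_one: "id \<in> G" and G_S: "s \<in> S \<Longrightarrow> s \<in> G" and G_comp: "g \<in> G \<Longrightarrow> h \<in> G \<Longrightarrow> g \<circ> h \<in> G"
  using generate.one[of homeo_group S] generate.incl[of s S homeo_group]
    generate.eng[of g homeo_group S h] by (auto simp: G_def)

lemma G_induct [consumes 1, case_names id S comp]: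
  assumes "g \<in> G" "P id" "\<And>s. s \<in> S \<Longrightarrow> P s" "\<And>g h. g \<in> G \<Longrightarrow> h \<in> G \<Longrightarrow> P g \<Longrightarrow> P h \<Longrightarrow> P (g \<circ> h)"
  shows "P g"
  using assms(1) unfolding G_def
proof (induction rule: generate.induct)
  case one
  show ?case using assms(2) by (simp only: homeo_group_simps)
next
  case (incl s)
  then show ?case by (rule assms(3))
next
  case (inv s)
  then show ?case using assms(3) S_inv by simp
next
  case (eng g h)
  then show ?case using assms(4) unfolding homeo_group_simps G_def by blast
qed

lemma G_carrier: "g \<in> G \<Longrightarrow> g \<in> carrier homeo_group"
proof (induction rule: G_induct)
  case id
  show ?case
    using group_homeo_group[THEN group.is_monoid, THEN monoid.one_closed] by (simp only: homeo_group_simps)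
next
  case (comp g h)
  then show ?case using group_homeo_group[THEN group.is_monoid, THEN monoid.m_closed, of g h]
    by (simp only: homeo_group_simps)
qed (rule S_carrier)

lemma G_inverse:
  "g \<in> G \<Longrightarrow> \<exists>g'\<in>G. g' \<circ> g = id \<and> g \<circ> g' = id"
proof (induction rule: G_induct)
  case id
  show ?case using G_one by (intro bexI[of _ id]) auto
next
  case (S s)
  then show ?case using G_S S_invol by (intro bexI[of _ s]) (auto simp: fun_eq_iff)
next
  case (comp g h)
  then obtain g' h' where gh: "g' \<in> G" "h' \<in> G" "g' \<circ> g = id" "g \<circ> g' = id" "h' \<circ> h = id" "h \<circ> h' = id" by blast
  then have e: "g' (g x) = x" "g (g' x) = x" "h' (h x) = x" "h (h' x) = x" for x
    by (simp_all add: fun_eq_iff)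
  show ?case using G_comp[OF gh(2,1)] by (intro bexI[of _ "h' \<circ> g'"]) (auto simp: fun_eq_iff e)
qed

text \<open>At a free point the two values that a generator can take differ, so its choice persists
  nearby. Compositions follow, as all positions on a free line are free.\<close>

lemma G_germ:
  "g \<in> G \<Longrightarrow> free x \<Longrightarrow> \<exists>U i. open U \<and> x \<in> U \<and> (\<forall>y\<in>U. g y = pos y i)"
proof (induction arbitrary: x rule: G_induct)
  case id
  show ?case by (intro exI[of _ UNIV] exI[of _ 0]) simp
next
  case (S s)
  then obtain k where k: "s \<in> frag k" using S_frag by blast
  obtain e where e: "e \<noteq> 0" "\<And>x. letter k x = pos x e" using letter_eq_pos by metis
  have ne: "letter k x \<noteq> x" using free_neq[OF S(2) e(1)] e(2) by simp
  show ?case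
  proof (cases "s x = x")
    case True
    have "open {y. s y \<noteq> letter k y}"
      by (intro cantor_open_neq[OF cantor] continuous_S S continuous_letter)
    then show ?thesis using frag_moves[OF k] True ne
      by (intro exI[of _ "{y. s y \<noteq> letter k y}"] exI[of _ 0]) auto
  next
    case False
    have "open {y. s y \<noteq> y}"
      by (rule cantor_open_neq[OF cantor continuous_S[OF S(1)] continuous_on_id])
    then show ?thesis using frag_moves[OF k] False
      by (intro exI[of _ "{y. s y \<noteq> y}"] exI[of _ e]) (auto simp flip: e)
  qed
next
  case (comp g h)
  obtain U i where U: "open U" "x \<in> U" "\<forall>y\<in>U. h y = pos y i" using comp.IH(2)[OF comp.prems] by blast
  obtain V j where V: "open V" "pos x i \<in> V" "\<forall>y\<in>V. g y = pos y j"
    using comp.IH(1)[OF free_pos[OF comp.prems]] by blast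
  have "open (U \<inter> (\<lambda>y. pos y i) -` V)" using U V continuous_pos by (intro open_Int open_vimage) auto
  moreover have "(g \<circ> h) y = pos y (chart i j)" if "y \<in> U \<inter> (\<lambda>y. pos y i) -` V" for y
    using that U V by (simp add: pos_pos)
  ultimately show ?case using U V by (intro exI[of _ "U \<inter> (\<lambda>y. pos y i) -` V"] exI[of _ "chart i j"]) auto
qed

lemma free_regular: "free x \<Longrightarrow> regular_point G x"
  unfolding regular_point_def
proof (intro ballI impI)
  fix g assume x: "free x" and g: "g \<in> G" "g x = x"
  obtain U i where U: "open U" "x \<in> U" "\<forall>y\<in>U. g y = pos y i" using G_germ[OF g(1) x] by blast
  then have "i = 0" using free_neq[OF x, of i 0] g by auto
  then show "\<exists>U. open U \<and> x \<in> U \<and> (\<forall>y\<in>U. g y = y)" using U by auto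
qed

lemma G_orbit: "g \<in> G \<Longrightarrow> \<exists>i. g x = pos x i"
proof (induction arbitrary: x rule: G_induct)
  case id
  show ?case by (intro exI[of _ 0]) simp
next
  case (S s)
  then show ?case using S_step[of s x 0] by auto
next
  case (comp g h)
  then show ?case by (metis comp_apply pos_pos)
qed

lemma pos_orbit: "\<exists>g\<in>G. pos x i = g x"
proof (rule pos_induct)
  show "\<exists>g\<in>G. x = g x" using G_one by (intro bexI[of _ id]) auto
  have *: "\<exists>g\<in>G. letter k y = g x" if y: "\<exists>g\<in>G. y = g x" for y k
  proof -
    obtain g where g: "g \<in> G" "y = g x" using y by blast
    obtain s where s: "s \<in> frag k" "s y = letter k y" using frag_ex by blast
    then have "s \<circ> g \<in> G" using G_comp[OF G_S g(1)] frag_cases by blast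
    then show ?thesis using g s by (intro bexI[of _ "s \<circ> g"]) auto
  qed
  show "\<exists>g\<in>G. a y = g x" if "\<exists>g\<in>G. y = g x" for y using *[OF that, of 0] by (simp add: letter_def)
  show "\<exists>g\<in>G. b y = g x" if "\<exists>g\<in>G. y = g x" for y using *[OF that, of 1] by (simp add: letter_def)
qed

lemma orbit_of_G: "orbit_of G x = range (pos x)"
proof
  show "orbit_of G x \<subseteq> range (pos x)" using G_orbit unfolding orbit_of_def by fastforce
  show "range (pos x) \<subseteq> orbit_of G x" using pos_orbit unfolding orbit_of_def by fastforce
qed

text \<open>A singular point is not free, so its line has a fold, whose end is fixed by
  \<open>letter i\<close>. Conjugation by an element moving \<xi> to that end carries the
  accumulation property along.\<close>

lemma singular_fold:
  assumes "purely_non_Hausdorff_singularity G \<xi>"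
  obtains i \<eta> where "letter i \<eta> = \<eta>" "\<And>h. h \<in> frag i \<Longrightarrow> \<eta> islimpt interior {y. h y = y}"
proof -
  have "\<not> free \<xi>" using assms free_regular unfolding purely_non_Hausdorff_singularity_def by blast
  then obtain i where i: "pos \<xi> i = pos \<xi> (i + 1)" by (rule not_free_fold[OF orbit_infinite])
  obtain g where g: "g \<in> G" "pos \<xi> i = g \<xi>" using pos_orbit by blast
  obtain g' where g': "g' \<in> G" "g' \<circ> g = id" "g \<circ> g' = id" using G_inverse[OF g(1)] by blast
  then have gg: "g' (g x) = x" "g (g' x) = x" for x by (simp_all add: fun_eq_iff)
  have gfix: "letter i (g \<xi>) = g \<xi>" using i letter_pos[of i \<xi>] g by simp
  show ?thesis
  proof (rule that[of i "g \<xi>"])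
    show "letter i (g \<xi>) = g \<xi>" by (rule gfix)
    fix h assume h: "h \<in> frag i"
    then have "h (g \<xi>) = g \<xi>" using frag_moves[OF h] gfix by metis
    then have "(g' \<circ> (h \<circ> g)) \<xi> = \<xi>" by (simp add: gg)
    moreover have "g' \<circ> (h \<circ> g) \<in> G" using G_comp G_S frag_cases h g g' by blast
    ultimately have lim: "\<xi> islimpt interior {y. (g' \<circ> (h \<circ> g)) y = y}"
      using assms unfolding purely_non_Hausdorff_singularity_def by blast
    show "g \<xi> islimpt interior {y. h y = y}"
    proof (rule islimptI)
      fix T assume T: "g \<xi> \<in> T" "open T"
      have "open (g -` T)" using homeo_groupD(1)[OF G_carrier[OF g(1)]] T(2) by (intro open_vimage)
      then obtain y where y: "y \<in> interior {y. (g' \<circ> (h \<circ> g)) y = y}" "g y \<in> T" "y \<noteq> \<xi>"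
        using islimptE[OF lim, of "g -` T"] T by auto
      let ?V = "g' -` interior {y. (g' \<circ> (h \<circ> g)) y = y}"
      have "open ?V" using homeo_groupD(1)[OF G_carrier[OF g'(1)]] by (intro open_vimage) auto
      moreover have "?V \<subseteq> {y. h y = y}"
      proof
        fix z assume "z \<in> ?V"
        then have "g' (h (g (g' z))) = g' z" using interior_subset by fastforce
        then have "g (g' (h z)) = g (g' z)" by (simp add: gg)
        then show "z \<in> {y. h y = y}" by (simp add: gg)
      qed
      moreover have "g y \<in> ?V" using y by (simp add: gg)
      ultimately have "g y \<in> interior {y. h y = y}" using interior_maximal by blast
      moreover have "g y \<noteq> g \<xi>" using y(3) gg by metis
      ultimately show "\<exists>y\<in>interior {y. h y = y}. y \<in> T \<and> y \<noteq> g \<xi>" using y by blast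
    qed
  qed
qed

section \<open>Balls of orbital graphs\<close>

lemma vertices_orbital: "vertices (orbital_graph S x) = range (pos x)"
  using orbit_of_G by (simp add: orbital_graph_def Let_def G_def)

lemma edges_orbital: "(u, s, v) \<in> edges (orbital_graph S x) \<longleftrightarrow> u \<in> range (pos x) \<and> s \<in> S \<and> v = s u"
  using vertices_orbital[of x] by (auto simp: orbital_graph_def Let_def)

lemma adjacency_step:
  assumes "(pos x i, v) \<in> adjacency (orbital_graph S x)"
  shows "\<exists>j. \<bar>j - i\<bar> \<le> 1 \<and> v = pos x j"
proof -
  obtain s where s: "s \<in> S" "v = s (pos x i) \<or> pos x i = s v"
    using assms by (auto simp: adjacency_def edges_orbital)
  then have "v = s (pos x i)" using S_invol by metis
  then have "v = pos x (step s (labels x) i)" using S_step s by simp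
  moreover have "\<bar>step s (labels x) i - i\<bar> \<le> 1"
    using step_bounds[where i=i and s=s and E="labels x"] by linarith
  ultimately show ?thesis by blast
qed

lemma adjacency_pow:
  "(x, v) \<in> adjacency (orbital_graph S x) ^^ n \<Longrightarrow> \<exists>j. \<bar>j\<bar> \<le> int n \<and> v = pos x j"
proof (induction n arbitrary: v)
  case 0
  then show ?case by (intro exI[of _ 0]) simp
next
  case (Suc n)
  then obtain u where u: "(x, u) \<in> adjacency (orbital_graph S x) ^^ n" "(u, v) \<in> adjacency (orbital_graph S x)" by auto
  then obtain i where i: "\<bar>i\<bar> \<le> int n" "u = pos x i" using Suc.IH by blast
  then obtain j where "\<bar>j - i\<bar> \<le> 1" "v = pos x j" using adjacency_step u by blast
  then show ?case using i by (intro exI[of _ j]) linarith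
qed

lemma adjacency_next:
  "(pos x i, pos x (i + 1)) \<in> adjacency (orbital_graph S x)"
  "(pos x (i + 1), pos x i) \<in> adjacency (orbital_graph S x)"
proof -
  obtain s where "s \<in> labels x i" using labels_nonempty by blast
  then have "(pos x i, s, pos x (i + 1)) \<in> edges (orbital_graph S x)"
    using frag_cases by (auto simp: edges_orbital labels_def)
  then show "(pos x i, pos x (i + 1)) \<in> adjacency (orbital_graph S x)"
    "(pos x (i + 1), pos x i) \<in> adjacency (orbital_graph S x)" by (auto simp: adjacency_def)
qed

lemma adjacency_pow_pos: "(x, pos x i) \<in> adjacency (orbital_graph S x) ^^ nat \<bar>i\<bar>"
proof (induction i rule: int_induct[where k=0])
  case (step1 i)
  then have "nat \<bar>i + 1\<bar> = Suc (nat \<bar>i\<bar>)" by simp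
  then show ?case using step1 adjacency_next(1)[of x i] by auto
next
  case (step2 i)
  then have "nat \<bar>i - 1\<bar> = Suc (nat \<bar>i\<bar>)" by simp
  then show ?case using step2 adjacency_next(2)[of x "i - 1"] by auto
qed simp

lemma graph_dist_le: "graph_dist (orbital_graph S x) x (pos x i) \<le> nat \<bar>i\<bar>"
  unfolding graph_dist_def by (rule Least_le) (rule adjacency_pow_pos)

lemma graph_dist_pos:
  assumes "v \<in> range (pos x)"
  obtains c where "\<bar>c\<bar> \<le> int (graph_dist (orbital_graph S x) x v)" "v = pos x c"
proof -
  obtain i where "v = pos x i" using assms by blast
  then have "(x, v) \<in> adjacency (orbital_graph S x) ^^ graph_dist (orbital_graph S x) x v"
    unfolding graph_dist_def using adjacency_pow_pos by (intro LeastI) auto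
  then show ?thesis using adjacency_pow that by blast
qed

lemma edges_ball:
  "(u, s, v) \<in> edges (graph_ball (orbital_graph S x) y r) \<longleftrightarrow>
     u \<in> vertices (graph_ball (orbital_graph S x) y r) \<and> v \<in> vertices (graph_ball (orbital_graph S x) y r)
       \<and> s \<in> S \<and> v = s u"
  by (auto simp: graph_ball_def Let_def edges_orbital vertices_orbital)

text \<open>The isomorphism preserves positions, by induction from the root: some element moves
  along each edge, its image cannot be a loop, and so it follows the same letter. Both ends of an
  edge must lie in the ball, hence the half-open range.\<close>

lemma iso_labels:
  assumes x: "free x"
    and iso: "rooted_isomorphic (graph_ball (orbital_graph S x) x r) x (graph_ball (orbital_graph S y) y' r) y'"
    and j: "- int r \<le> j" "j < int r"
  shows "labels y' j = labels x j"
proof -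
  let ?X = "graph_ball (orbital_graph S x) x r" and ?Y = "graph_ball (orbital_graph S y) y' r"
  obtain \<phi> where \<phi>: "bij_betw \<phi> (vertices ?X) (vertices ?Y)" "\<phi> x = y'"
    "\<And>u v s. u \<in> vertices ?X \<Longrightarrow> v \<in> vertices ?X \<Longrightarrow> (u, s, v) \<in> edges ?X \<longleftrightarrow> (\<phi> u, s, \<phi> v) \<in> edges ?Y"
    using iso unfolding rooted_isomorphic_def by blast
  have V: "pos x i \<in> vertices ?X" if "\<bar>i\<bar> \<le> int r" for i
    using graph_dist_le[of x i] that by (auto simp: graph_ball_def Let_def vertices_orbital)
  have E: "s (pos x i) = pos x i' \<longleftrightarrow> s (\<phi> (pos x i)) = \<phi> (pos x i')"
    if "s \<in> S" "\<bar>i\<bar> \<le> int r" "\<bar>i'\<bar> \<le> int r" for s i i'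
  proof -
    have "\<phi> (pos x i) \<in> vertices ?Y" "\<phi> (pos x i') \<in> vertices ?Y"
      using \<phi>(1) V that bij_betwE by blast+
    moreover have "pos x i \<in> vertices ?X" "pos x i' \<in> vertices ?X" using V that by blast+
    moreover from this have "(pos x i, s, pos x i') \<in> edges ?X \<longleftrightarrow> (\<phi> (pos x i), s, \<phi> (pos x i')) \<in> edges ?Y"
      by (rule \<phi>(3))
    ultimately have "pos x i' = s (pos x i) \<longleftrightarrow> \<phi> (pos x i') = s (\<phi> (pos x i))"
      using that(1) unfolding edges_ball by blast
    then show ?thesis by metis
  qed
  have ne: "\<phi> (pos x i) \<noteq> \<phi> (pos x i')" if "\<bar>i\<bar> \<le> int r" "\<bar>i'\<bar> \<le> int r" "i \<noteq> i'" for i i'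
    using \<phi>(1) V that free_neq[OF x that(3)] unfolding bij_betw_def inj_on_def by blast
  have move: "\<phi> (pos x i') = letter k (\<phi> (pos x i))"
    if "\<bar>i\<bar> \<le> int r" "\<bar>i'\<bar> \<le> int r" "i \<noteq> i'" "pos x i' = letter k (pos x i)" for i i' k
  proof -
    obtain s where s: "s \<in> frag k" "s (pos x i) = letter k (pos x i)" using frag_ex by blast
    then have "s (\<phi> (pos x i)) = \<phi> (pos x i')" using E[of s i i'] that frag_cases by auto
    then show ?thesis using frag_moves[OF s(1), of "\<phi> (pos x i)"] ne[OF that(1,2,3)] by auto
  qed
  have pos: "\<bar>i\<bar> \<le> int r \<Longrightarrow> \<phi> (pos x i) = pos y' i" for i
  proof (induction i rule: int_induct[where k=0])
    case (step1 i)
    then have "\<phi> (pos x (i + 1)) = letter i (\<phi> (pos x i))" by (intro move) (auto simp: letter_pos)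
    then show ?case using step1 by (simp add: letter_pos)
  next
    case (step2 i)
    then have "\<phi> (pos x (i - 1)) = letter (i - 1) (\<phi> (pos x i))" 
      using letter_pos'[of "i - 1" x] by (intro move) auto
    then show ?case using step2 letter_pos'[of "i - 1" y'] by simp
  qed (simp add: \<phi>)
  have j': "\<bar>j\<bar> \<le> int r" "\<bar>j + 1\<bar> \<le> int r" using j by auto
  show ?thesis
    using E[OF _ j'] frag_cases[of j] unfolding labels_def pos[OF j'(1)] pos[OF j'(2)] by blast
qed

end

section \<open>The line system of a purely non-Hausdorff singularity\<close>

locale folded_fragmentation = dihedral_fragmentation a b A B
  for a b :: "'a::topological_space \<Rightarrow> 'a" and A B +
  fixes \<xi> :: 'a
  assumes fixed: "a \<xi> = \<xi>"
    and accumulates: "h \<in> A \<Longrightarrow> \<xi> islimpt interior {y. h y = y}"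
    and repetitive_graphs: "linearly_repetitive (A \<union> B)"
begin

lemma fold_xi: "pos \<xi> 0 = pos \<xi> (0 + 1)"
  using letter_pos[of 0 \<xi>] fixed by (simp add: letter_def)

text \<open>Position 1 is again \<xi>, and from there the line is seen reversed.\<close>

lemma labels_xi_abs: "labels \<xi> \<bar>j\<bar> = labels \<xi> j"
proof -
  have "pos \<xi> 1 = \<xi>" using fold_xi by simp
  then have "labels \<xi> k = labels \<xi> (- k)" for k
    using fun_cong[OF labels_pos[of \<xi> 1], of k] by (simp add: recenter_def)
  then show ?thesis by (cases "j \<ge> 0") auto
qed

text \<open>Edge 0 is the only fold, so the ends of edge \<open>j\<close> differ at \<xi>. Therefore
  moving along the edge and not moving along it are both expressed by inequalities, that is, by open
  conditions.\<close>

lemma labels_near: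
  assumes "j \<noteq> 0"
  shows "\<forall>\<^sub>F \<eta> in nhds \<xi>. labels \<eta> j = labels \<xi> j"
proof -
  have ne: "pos \<xi> j \<noteq> pos \<xi> (j + 1)" using fold_unique[OF fold_xi] assms by blast
  have "\<forall>\<^sub>F \<eta> in nhds \<xi>. s \<in> labels \<eta> j \<longleftrightarrow> s \<in> labels \<xi> j" if s: "s \<in> frag j" for s
  proof -
    have c: "continuous_on UNIV (\<lambda>\<eta>. s (pos \<eta> j))"
      using continuous_on_compose2[OF continuous_S continuous_pos] s frag_cases by blast
    show ?thesis
    proof (cases "s \<in> labels \<xi> j")
      case True
      have "open {\<eta>. s (pos \<eta> j) \<noteq> pos \<eta> j}" by (rule cantor_open_neq[OF cantor c continuous_pos])
      moreover have "\<xi> \<in> {\<eta>. s (pos \<eta> j) \<noteq> pos \<eta> j}" using True ne by (simp add: labels_def)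
      ultimately have "\<forall>\<^sub>F \<eta> in nhds \<xi>. s (pos \<eta> j) \<noteq> pos \<eta> j" unfolding eventually_nhds by blast
      then show ?thesis
      proof eventually_elim
        case (elim \<eta>)
        then have "s (pos \<eta> j) = pos \<eta> (j + 1)" using frag_moves[OF s, of "pos \<eta> j"] by (simp add: letter_pos)
        then show ?case using True s by (simp add: labels_def)
      qed
    next
      case False
      have "open {\<eta>. s (pos \<eta> j) \<noteq> pos \<eta> (j + 1)}" by (rule cantor_open_neq[OF cantor c continuous_pos])
      moreover have "\<xi> \<in> {\<eta>. s (pos \<eta> j) \<noteq> pos \<eta> (j + 1)}" using False s by (simp add: labels_def)
      ultimately have "\<forall>\<^sub>F \<eta> in nhds \<xi>. s (pos \<eta> j) \<noteq> pos \<eta> (j + 1)" unfolding eventually_nhds by blast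
      then show ?thesis
        by eventually_elim (use False in \<open>simp add: labels_def\<close>)
    qed
  qed
  then have "\<forall>\<^sub>F \<eta> in nhds \<xi>. \<forall>s\<in>frag j. s \<in> labels \<eta> j \<longleftrightarrow> s \<in> labels \<xi> j"
    by (intro eventually_ball_finite finite_frag ballI)
  then show ?thesis by eventually_elim (auto simp: labels_def)
qed

lemma free_near:
  assumes h: "h \<in> A"
  obtains \<eta> where "free \<eta>" "h \<eta> = \<eta>" "\<And>j. \<bar>j\<bar> \<le> int r \<Longrightarrow> labels \<eta> j = pal_line (labels \<xi>) (labels \<eta> 0) j"
proof -
  define P where "P = (\<lambda>\<eta>. \<forall>j\<in>{- int r..int r} - {0}. labels \<eta> j = labels \<xi> j)"
  have "\<forall>\<^sub>F \<eta> in nhds \<xi>. P \<eta>"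
    unfolding P_def by (intro eventually_ball_finite ballI labels_near) auto
  then obtain U where U: "open U" "\<xi> \<in> U" 
    "\<forall>\<eta>\<in>U. P \<eta>"
    unfolding eventually_nhds by blast
  \<comment> \<open>The element \<open>h\<close> is the identity on a nonempty open part of
    \<open>U\<close>, where a free point can be found.\<close>
  obtain y where "y \<in> interior {y. h y = y}" "y \<in> U"
    using islimptE[OF accumulates[OF h] U(2,1)] by blast
  then have "open (U \<inter> interior {y. h y = y})" "U \<inter> interior {y. h y = y} \<noteq> {}" using U by auto
  then obtain \<eta> where \<eta>: "\<eta> \<in> U \<inter> interior {y. h y = y}" "free \<eta>" by (rule free_dense)
  have "h \<eta> = \<eta>" using \<eta> interior_subset by blast
  moreover have "labels \<eta> j = pal_line (labels \<xi>) (labels \<eta> 0) j" if "\<bar>j\<bar> \<le> int r" for j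
  proof (cases "j = 0")
    case False
    then have "j \<in> {- int r..int r} - {0}" using that by auto
    then have "labels \<eta> j = labels \<xi> j" using U(3) \<eta> unfolding P_def by blast
    then show ?thesis using False by (simp add: pal_line_def labels_xi_abs)
  qed (simp add: pal_line_def)
  ultimately show ?thesis using that \<eta> by blast
qed

definition lines :: "(int \<Rightarrow> ('a \<Rightarrow> 'a) set) set" where "lines = labels ` Collect free"

definition central :: "('a \<Rightarrow> 'a) set set" where
  "central = {D. \<forall>r::nat. \<exists>x. free x \<and> (\<forall>j. \<bar>j\<bar> \<le> int r \<longrightarrow> labels x j = pal_line (labels \<xi>) D j)}"

lemma central_sub:
  assumes "D \<in> central" shows "D \<subseteq> A" "D \<noteq> {}"
proof -
  obtain x where "free x" "\<forall>j. \<bar>j\<bar> \<le> int 0 \<longrightarrow> labels x j = pal_line (labels \<xi>) D j"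
    using assms unfolding central_def by blast
  then have "labels x 0 = D" by (simp add: pal_line_def)
  then show "D \<subseteq> A" "D \<noteq> {}" using labels_nonempty[of x 0] by (auto simp: labels_def frag_def)
qed

lemma frag_0: "frag 0 = A" by (simp add: frag_def)

lemma finite_A: "finite A" using finite_frag[of 0] by (simp add: frag_0)

text \<open>The central label may vary with the radius; since \<open>A\<close> is finite, one label
  occurs for infinitely many radii and so for all.\<close>

lemma central_fixed:
  assumes h: "h \<in> A"
  obtains D x where "D \<in> central" "free x" "labels x 0 = D" "h x = x"
proof -
  have "\<exists>\<eta>. free \<eta> \<and> h \<eta> = \<eta> \<and> (\<forall>j. \<bar>j\<bar> \<le> int r \<longrightarrow> labels \<eta> j = pal_line (labels \<xi>) (labels \<eta> 0) j)" for r
    by (rule free_near[OF h, of r]) blast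
  then obtain f where f: "\<And>r. free (f r)" "\<And>r. h (f r) = f r"
     "\<And>r j. \<bar>j\<bar> \<le> int r \<Longrightarrow> labels (f r) j = pal_line (labels \<xi>) (labels (f r) 0) j" by metis
  have "(\<lambda>r. labels (f r) 0) ` UNIV \<subseteq> Pow A" by (auto simp: labels_def frag_def)
  then have "finite ((\<lambda>r. labels (f r) 0) ` UNIV)"
    using finite_A by (meson finite_Pow_iff finite_subset)
  then obtain r0 where r0: "infinite {r. labels (f r) 0 = labels (f r0) 0}"
    using pigeonhole_infinite[of "UNIV :: nat set" "\<lambda>r. labels (f r) 0"] by auto
  have "labels (f r0) 0 \<in> central"
    unfolding central_def
  proof (intro CollectI allI)
    fix r :: nat
    obtain r' where r': "r' \<ge> r" "labels (f r') 0 = labels (f r0) 0"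
      using r0 unfolding infinite_nat_iff_unbounded_le by auto
    have "labels (f r') j = pal_line (labels \<xi>) (labels (f r0) 0) j" if "\<bar>j\<bar> \<le> int r" for j
    proof -
      have "\<bar>j\<bar> \<le> int r'" using that r'(1) by simp
      from f(3)[OF this, unfolded r'(2)] show ?thesis .
    qed
    then show "\<exists>x. free x \<and> (\<forall>j. \<bar>j\<bar> \<le> int r \<longrightarrow> labels x j = pal_line (labels \<xi>) (labels (f r0) 0) j)"
      using f(1)[of r'] by blast
  qed
  then show ?thesis using that f by blast
qed

text \<open>A letter of \<open>A\<close> acts on the pair of \<open>x\<close> and \<open>a x\<close>
  trivially or as the swap, so only the parity of the swaps matters. One product \<open>h\<close>
  serves all \<open>x\<close>.\<close>

lemma product_parity:
  assumes "finite U" "\<And>u. u \<in> U \<Longrightarrow> W u \<in> A"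
  shows "\<exists>h\<in>A. \<forall>x. h x = (if even (card {u \<in> U. W u \<in> labels x 0}) then x else a x)"
  using assms
proof (induction U rule: finite_induct)
  case empty
  show ?case using frag_id[of 0] by (intro bexI[of _ id]) (auto simp: frag_0)
next
  case (insert u U)
  then obtain h where h: "h \<in> A" "\<forall>x. h x = (if even (card {u \<in> U. W u \<in> labels x 0}) then x else a x)" by auto
  have Wu: "W u \<in> frag 0" using insert by (simp add: frag_0)
  have sw: "W u x = a x \<and> W u (a x) = x" if "W u \<in> labels x 0" for x
    using that labels_back[of "W u" x 0] letter_pos[of 0 x] by (auto simp: labels_def letter_def)
  have st: "W u x = x \<and> W u (a x) = a x" if "W u \<notin> labels x 0" for x
    using frag_moves[OF Wu, of x] frag_moves[OF Wu, of "a x"] that labels_backI[OF Wu, of x] Wu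
      letter_pos[of 0 x] inv_a by (auto simp: labels_def letter_def)
  have "{v \<in> insert u U. W v \<in> labels x 0} = 
    (if W u \<in> labels x 0 then insert u {v \<in> U. W v \<in> labels x 0} else {v \<in> U. W v \<in> labels x 0})" for x
    by auto
  then have "card {v \<in> insert u U. W v \<in> labels x 0} = 
    (if W u \<in> labels x 0 then Suc (card {v \<in> U. W v \<in> labels x 0}) else card {v \<in> U. W v \<in> labels x 0})" for x
    using insert by simp
  then have "(W u \<circ> h) x = (if even (card {v \<in> insert u U. W v \<in> labels x 0}) then x else a x)" for x
    using h(2) sw[of x] st[of x] by auto
  moreover have "W u \<circ> h \<in> A" using frag_comp[OF Wu, of h] h by (simp add: frag_0)
  ultimately show ?case by blast
qed

lemma repetitive_labels:
  obtains K :: nat where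
    "\<And>r x y. r \<ge> 2 \<Longrightarrow> free x \<Longrightarrow> free y \<Longrightarrow>
      \<exists>c. \<bar>c\<bar> \<le> int K * int r \<and> (\<forall>j. - int r \<le> j \<and> j < int r \<longrightarrow> labels (pos y c) j = labels x j)"
proof -
  obtain K0 :: real where K0: "K0 > 1" 
   "\<And>r x y. r > 1 \<Longrightarrow> regular_point G x \<Longrightarrow>
             \<exists>y'\<in>vertices (orbital_graph S y).
                real (graph_dist (orbital_graph S y) y y') < K0 * real r \<and>
                rooted_isomorphic
                  (graph_ball (orbital_graph S x) x r) x
                  (graph_ball (orbital_graph S y) y' r) y'"
    using repetitive_graphs unfolding linearly_repetitive_def G_def S_def by blast
  define K where "K = nat \<lceil>K0\<rceil>"
  have K: "K0 \<le> real K" by (simp add: K_def real_nat_ceiling_ge)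
  show ?thesis
  proof (rule that[of K])
    fix r :: nat and x y assume r: "r \<ge> 2" and x: "free x" and y: "free y"
    obtain y' where y': "y' \<in> range (pos y)" "real (graph_dist (orbital_graph S y) y y') < K0 * real r"
      "rooted_isomorphic (graph_ball (orbital_graph S x) x r) x (graph_ball (orbital_graph S y) y' r) y'"
      using K0(2)[of r x y] r free_regular[OF x] by (auto simp: vertices_orbital)
    obtain c where c: "\<bar>c\<bar> \<le> int (graph_dist (orbital_graph S y) y y')" "y' = pos y c"
      by (rule graph_dist_pos[OF y'(1)])
    have "real (graph_dist (orbital_graph S y) y y') \<le> real (K * r)"
      using y'(2) mult_right_mono[OF K, of "real r"] by simp
    then have "graph_dist (orbital_graph S y) y y' \<le> K * r" by (simp only: of_nat_le_iff)
    then have "\<bar>c\<bar> \<le> int K * int r" using c(1) by (simp flip: of_nat_mult)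
    then show "\<exists>c. \<bar>c\<bar> \<le> int K * int r \<and> (\<forall>j. - int r \<le> j \<and> j < int r \<longrightarrow> labels (pos y c) j = labels x j)"
      using iso_labels[OF x y'(3)] c(2) by blast
  qed
qed

lemma lines_system:
  obtains K where "line_system S lines (labels \<xi>) central K"
proof -
  obtain K where K: "\<And>r x y. r \<ge> 2 \<Longrightarrow> free x \<Longrightarrow> free y \<Longrightarrow>
      \<exists>c. \<bar>c\<bar> \<le> int K * int r \<and> (\<forall>j. - int r \<le> j \<and> j < int r \<longrightarrow> labels (pos y c) j = labels x j)"
    by (rule repetitive_labels) blast
  have "line_system S lines (labels \<xi>) central K"
  proof
    show "disj_line E" if "E \<in> lines" for E using that disj_labels by (auto simp: lines_def)
    show "recenter E v \<in> lines" if "E \<in> lines" for E v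
      using that free_pos by (auto simp: lines_def simp flip: labels_pos)
    show "\<exists>c. \<bar>c\<bar> \<le> int K * int r \<and> (\<forall>j. - int r \<le> j \<and> j < int r \<longrightarrow> recenter E' c j = E j)"
      if "2 \<le> r" "E \<in> lines" "E' \<in> lines" for r E E'
      using that K[OF that(1)] by (auto simp: lines_def simp flip: labels_pos)
    have "central \<subseteq> Pow A" using central_sub by blast
    then show "finite central" using finite_A by (meson finite_Pow_iff finite_subset)
    show "\<exists>E\<in>lines. \<forall>j. \<bar>j\<bar> \<le> int r \<longrightarrow> E j = pal_line (labels \<xi>) D j" if "D \<in> central" for D r
      using that unfolding central_def lines_def by blast
    show "\<exists>D\<in>central. even (card {u \<in> U. W u \<in> D})" if U: "finite U" "\<forall>u\<in>U. W u \<in> S" for U :: "nat set" and W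
    proof -
      let ?U = "{u \<in> U. W u \<in> A}"
      have "\<exists>h\<in>A. \<forall>x. h x = (if even (card {u \<in> ?U. W u \<in> labels x 0}) then x else a x)"
        by (rule product_parity) (use U(1) in auto)
      then obtain h where h: "h \<in> A" "\<forall>x. h x = (if even (card {u \<in> ?U. W u \<in> labels x 0}) then x else a x)"
        by (rule bexE)
      \<comment> \<open>The product fixes the free point \<open>x\<close>, while \<open>a\<close>
        moves it; so the number of swaps at \<open>x\<close> is even.\<close>
      obtain D x where D: "D \<in> central" "free x" "labels x 0 = D" "h x = x" by (rule central_fixed[OF h(1)])
      have "a x \<noteq> x" using free_neq[OF D(2), of 1 0] letter_pos[of 0 x] by (simp add: letter_def)
      then have "even (card {u \<in> ?U. W u \<in> D})" using h(2)[rule_format, of x] D(3,4) by (simp split: if_splits)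
      moreover have "{u \<in> ?U. W u \<in> D} = {u \<in> U. W u \<in> D}" using central_sub(1)[OF D(1)] by blast
      ultimately show ?thesis using D(1) by auto
    qed
    show "D \<noteq> {}" "D \<subseteq> S" if "D \<in> central" for D using central_sub[OF that] by (auto simp: S_def)
  qed
  then show ?thesis by (rule that)
qed

text \<open>The last letter of a word acts first, hence \<open>rev\<close>. The identity, which
  belongs to \<open>S\<close>, pads all words to the common duration \<open>n\<close>.\<close>

lemma foldr_walk:
  assumes ws: "set ws \<subseteq> S" "length ws \<le> n"
    and W: "W = (\<lambda>u. if u < length ws then rev ws ! u else id)"
  shows "foldr (\<circ>) ws id x = pos x (walk W (labels x) 0 0 n)"
proof -
  have id_S: "id \<in> S" using frag_id[of 0] frag_cases by blast
  have WS: "W u \<in> S" for u 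
  proof (cases "u < length ws")
    case True
    then have "rev ws ! u \<in> set ws" by (metis length_rev nth_mem set_rev)
    then show ?thesis using ws True by (auto simp: W)
  qed (simp add: W id_S)
  have step: "pos x (walk W (labels x) 0 0 (Suc k)) = W k (pos x (walk W (labels x) 0 0 k))" for k
    using S_step[OF WS[of k], of x] by simp
  have "k \<le> length ws \<Longrightarrow> foldr (\<circ>) (rev (take k (rev ws))) id x = pos x (walk W (labels x) 0 0 k)" for k
  proof (induction k)
    case (Suc k)
    then have "take (Suc k) (rev ws) = take k (rev ws) @ [W k]" by (simp add: take_Suc_conv_app_nth W)
    then have "foldr (\<circ>) (rev (take (Suc k) (rev ws))) id x = W k (foldr (\<circ>) (rev (take k (rev ws))) id x)"
      by simp
    moreover have "k \<le> length ws" using Suc.prems by simp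
    ultimately show ?case by (simp only: Suc.IH step)
  qed simp
  from this[of "length ws"] have 1: "foldr (\<circ>) ws id x = pos x (walk W (labels x) 0 0 (length ws))" by simp
  have "pos x (walk W (labels x) 0 0 (length ws + m)) = pos x (walk W (labels x) 0 0 (length ws))" for m
  proof (induction m)
    case (Suc m)
    have "pos x (walk W (labels x) 0 0 (length ws + Suc m)) = W (length ws + m) (pos x (walk W (labels x) 0 0 (length ws + m)))"
      using step[of "length ws + m"] by (simp only: add_Suc_right)
    then show ?case using Suc by (simp add: W del: walk.simps)
  qed simp
  from this[of "n - length ws"] 1 ws(2) show ?thesis by simp
qed

lemma foldr_G: "set ws \<subseteq> S \<Longrightarrow> foldr (\<circ>) ws id \<in> G"
proof (induction ws)
  case (Cons s ws)
  then have "s \<in> S" "set ws \<subseteq> S" by auto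
  then have "s \<circ> foldr (\<circ>) ws id \<in> G" using G_comp[OF G_S] Cons.IH by blast
  moreover have "foldr (\<circ>) (s # ws) id = s \<circ> foldr (\<circ>) ws id" by simp
  ultimately show ?case by (simp only:)
qed (simp only: foldr.simps G_one id_apply)

lemma continuous_G:
  "g \<in> G \<Longrightarrow> continuous_on UNIV g"
  using homeo_groupD(1) G_carrier by blast

lemma G_eqI:
  assumes "g \<in> G" "g' \<in> G" "\<And>x. free x \<Longrightarrow> g x = g' x"
  shows "g = g'"
proof (rule ccontr)
  assume "g \<noteq> g'"
  then have "{x. g x \<noteq> g' x} \<noteq> {}" by auto
  moreover have "open {x. g x \<noteq> g' x}" using assms by (intro cantor_open_neq[OF cantor] continuous_G)
  ultimately obtain x where "x \<in> {x. g x \<noteq> g' x}" "free x" using free_dense by blast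
  then show False using assms by blast
qed

theorem growth_bound:
  "\<exists>C\<^sub>1 C\<^sub>2 :: real. C\<^sub>1 > 0 \<and> C\<^sub>2 > 0 \<and>
     (\<forall>n::nat. n \<ge> 1 \<longrightarrow> real (growth_function homeo_group (A \<union> B) n)
        \<le> exp (C\<^sub>1 * real n * exp (- C\<^sub>2 * sqrt (ln (real n)))))"
proof -
  obtain K where "line_system S lines (labels \<xi>) central K" by (rule lines_system)
  then interpret line_system S lines "labels \<xi>" central K .
  obtain C1 C2 :: real where C: "C1 > 0" "C2 > 0"
    "\<And>n. n \<ge> 1 \<Longrightarrow> real (card (endpoints n ` {W. \<forall>u. W u \<in> S})) \<le> exp (C1 * real n * exp (- C2 * sqrt (ln (real n))))"
    by (rule endpoints_growth) blast
  have le: "growth_function homeo_group (A \<union> B) n \<le> card (endpoints n ` {W. \<forall>u. W u \<in> S})" for n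
  proof -
    define P where "P = {foldr (\<circ>) ws id | ws. length ws \<le> n \<and> set ws \<subseteq> S}"
    \<comment> \<open>Generators are their own inverses, so words over \<open>S\<close>
      suffice.\<close>
    have inv_S: "(\<lambda>s. inv\<^bsub>homeo_group\<^esub> s) ` S = S" using S_inv by force
    have "(\<otimes>\<^bsub>homeo_group\<^esub>) = ((\<circ>) :: ('a \<Rightarrow> 'a) \<Rightarrow> _)" by (simp add: fun_eq_iff)
    then have g: "growth_function homeo_group (A \<union> B) n = card P"
      unfolding growth_function_def P_def S_def[symmetric] inv_S by simp
    have PG: "g \<in> G" if "g \<in> P" for g
      using that foldr_G unfolding P_def by blast
    have "\<exists>W. (\<forall>u. W u \<in> S) \<and> (\<forall>x. g x = pos x (walk W (labels x) 0 0 n))" if gP: "g \<in> P" for g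
    proof -
      obtain ws where ws: "g = foldr (\<circ>) ws id" "set ws \<subseteq> S" "length ws \<le> n"
        using gP unfolding P_def by blast
      define W where "W = (\<lambda>u. if u < length ws then rev ws ! u else id)"
      have "id \<in> S" using frag_id[of 0] frag_cases by blast
      moreover have "rev ws ! u \<in> S" if "u < length ws" for u
        using that ws(2) nth_mem[of u "rev ws"] by auto
      ultimately have "\<forall>u. W u \<in> S" by (simp add: W_def)
      then show ?thesis using foldr_walk[OF ws(2,3) W_def] ws(1) by blast
    qed
    then obtain w where w: "\<And>g u. g \<in> P \<Longrightarrow> w g u \<in> S"
      "\<And>g x. g \<in> P \<Longrightarrow> g x = pos x (walk (w g) (labels x) 0 0 n)" by metis
    have "inj_on (\<lambda>g. endpoints n (w g)) P"
    proof (rule inj_onI)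
      fix g g' assume P: "g \<in> P" "g' \<in> P" and eq: "endpoints n (w g) = endpoints n (w g')"
      show "g = g'"
      proof (rule G_eqI)
        fix x assume "free x"
        then have "labels x \<in> lines" by (simp add: lines_def)
        then have "walk (w g) (labels x) 0 0 n = walk (w g') (labels x) 0 0 n"
          using fun_cong[OF eq, of "labels x"] by (simp add: endpoints_def)
        then show "g x = g' x" by (simp only: w(2)[OF P(1)] w(2)[OF P(2)])
      qed (use P PG in auto)
    qed
    moreover have "(\<lambda>g. endpoints n (w g)) ` P \<subseteq> endpoints n ` {W. \<forall>u. W u \<in> S}" using w(1) by blast
    ultimately show ?thesis unfolding g using finite_endpoints by (intro card_inj_on_le)
  qed
  have "real (growth_function homeo_group (A \<union> B) n) \<le> exp (C1 * real n * exp (- C2 * sqrt (ln (real n))))"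
    if "n \<ge> 1" for n
    using of_nat_mono[OF le[of n]] by (rule order_trans) (rule C(3)[OF that])
  then show ?thesis using C(1,2) by blast
qed

end

theorem theorem5p6:
  fixes a b :: "'a::topological_space \<Rightarrow> 'a"
    and A B G :: "('a \<Rightarrow> 'a) set"
    and \<xi> :: 'a
  assumes "is_cantor_set TYPE('a)"
    and "period_two a" and "period_two b"
    and "minimal_action (generate homeo_group {a, b})"
    and "fragmentation a A" and "fragmentation b B"
    and "G = generate homeo_group (A \<union> B)"
    and "purely_non_Hausdorff_singularity G \<xi>"
    and "linearly_repetitive (A \<union> B)"
  shows "\<exists>C\<^sub>1 C\<^sub>2 :: real. C\<^sub>1 > 0 \<and> C\<^sub>2 > 0 \<and>
           (\<forall>n::nat. n \<ge> 1 \<longrightarrow>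
              real (growth_function homeo_group (A \<union> B) n)
                \<le> exp (C\<^sub>1 * real n * exp (- C\<^sub>2 * sqrt (ln (real n)))))"
proof -
  interpret D: dihedral_fragmentation a b A B by unfold_locales (use assms in auto)
  have "G = D.G" using assms(7) by (simp add: D.G_def D.S_def)
  then have "purely_non_Hausdorff_singularity D.G \<xi>" using assms(8) by simp
  then obtain i \<eta> where \<eta>: "D.letter i \<eta> = \<eta>" "\<forall>h\<in>D.frag i. \<eta> islimpt interior {y. h y = y}"
    by (rule D.singular_fold) blast
  show ?thesis
  proof (cases "even i")
    case True
    interpret folded_fragmentation a b A B \<eta>
      by unfold_locales (use True \<eta> assms in \<open>auto simp: D.letter_def D.frag_def\<close>)
    show ?thesis by (rule growth_bound)
  next
    case False
    \<comment> \<open>At an odd fold \<open>b\<close> fixes the point, and the roles of the two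
      involutions are exchanged.\<close>
    interpret folded_fragmentation b a B A \<eta>
      by unfold_locales (use False \<eta> assms in \<open>auto simp: D.letter_def D.frag_def insert_commute Un_commute\<close>)
    show ?thesis using growth_bound by (simp only: Un_commute)
  qed
qed

end
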